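(* Let $R$ be a commutative ring with unity which is locally a domain, that is, $R_M$ is an integral domain for each maximal ideal $M$ of $R$. Let $f(X)\in R[X]$ be a nonzero polynomial. Then $f$ is Gaussian over $R$ if and only if its content $\mathfrak{c}_R(f)$ is a locally principal ideal of $R$.
   Context: For a commutative ring $R$ with unity and $f(X)=a_nX^n+\dots+a_1X+a_0\in R[X]$, the content $\mathfrak{c}(f)=\mathfrak{c}_R(f)$ is the ideal of $R$ generated by the coefficients $a_0,\dots,a_n$. The polynomial $f$ is called Gaussian (over $R$) if $\mathfrak{c}(fg)=\mathfrak{c}(f)\mathfrak{c}(g)$ for all $g(X)\in R[X]$. An ideal $I$ of $R$ is locally principal if $IR_M$ is a principal ideal of $R_M$ for each maximal ideal $M$ of $R$. (A nonzero ideal of an integral domain is invertible if and only if it is finitely generated and locally principal; a content ideal is always finitely generated, so for $R$ an integral domain the condition on $\mathfrak{c}_R(f)$ means that it is invertible.) *)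

theory Defs
  imports "HOL-Algebra.UnivPoly" "HOL-Algebra.Ideal_Product"
begin

section \<open>Localization of a commutative ring\<close>

text \<open>
  Fractions with numerator in the ring \<open>R\<close> and denominator in a multiplicative set \<open>S\<close>.
  The factor \<open>u\<close> is needed because \<open>R\<close> may have zero divisors.
\<close>

definition loc_rel :: "('a, 'm) ring_scheme \<Rightarrow> 'a set \<Rightarrow> (('a \<times> 'a) \<times> ('a \<times> 'a)) set"
  where "loc_rel R S =
    {((a, s), (b, t)). a \<in> carrier R \<and> s \<in> S \<and> b \<in> carrier R \<and> t \<in> S \<and>
       (\<exists>u \<in> S. u \<otimes>\<^bsub>R\<^esub> (a \<otimes>\<^bsub>R\<^esub> t) = u \<otimes>\<^bsub>R\<^esub> (b \<otimes>\<^bsub>R\<^esub> s))}"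

definition loc_frac :: "('a, 'm) ring_scheme \<Rightarrow> 'a set \<Rightarrow> 'a \<Rightarrow> 'a \<Rightarrow> ('a \<times> 'a) set"
  where "loc_frac R S a s = loc_rel R S `` {(a, s)}"

text \<open>
  The unions below run over all representatives of the two classes; by \<open>loc_frac_mult\<close> and
  \<open>loc_frac_add\<close> every choice contributes the same class.
\<close>

definition localization :: "('a, 'm) ring_scheme \<Rightarrow> 'a set \<Rightarrow> ('a \<times> 'a) set ring"
  where "localization R S =
    \<lparr> carrier = (carrier R \<times> S) // loc_rel R S,
      mult = (\<lambda>A B. \<Union>(a, s) \<in> A. \<Union>(b, t) \<in> B. loc_frac R S (a \<otimes>\<^bsub>R\<^esub> b) (s \<otimes>\<^bsub>R\<^esub> t)),
      one = loc_frac R S \<one>\<^bsub>R\<^esub> \<one>\<^bsub>R\<^esub>,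
      zero = loc_frac R S \<zero>\<^bsub>R\<^esub> \<one>\<^bsub>R\<^esub>,
      add = (\<lambda>A B. \<Union>(a, s) \<in> A. \<Union>(b, t) \<in> B.
        loc_frac R S ((a \<otimes>\<^bsub>R\<^esub> t) \<oplus>\<^bsub>R\<^esub> (b \<otimes>\<^bsub>R\<^esub> s)) (s \<otimes>\<^bsub>R\<^esub> t)) \<rparr>"

definition loc_map :: "('a, 'm) ring_scheme \<Rightarrow> 'a set \<Rightarrow> 'a \<Rightarrow> ('a \<times> 'a) set"
  where "loc_map R S a = loc_frac R S a \<one>\<^bsub>R\<^esub>"

locale cring_mult_set = cring R + submonoid S R for R (structure) and S
begin

abbreviation "L \<equiv> localization R S"
abbreviation "fr \<equiv> loc_frac R S"

lemma S_carr [simp, intro]: "s \<in> S \<Longrightarrow> s \<in> carrier R"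
  using subset by blast

lemma loc_rel_iff:
  "((a, s), (b, t)) \<in> loc_rel R S \<longleftrightarrow>
     a \<in> carrier R \<and> s \<in> S \<and> b \<in> carrier R \<and> t \<in> S \<and>
     (\<exists>u \<in> S. u \<otimes> (a \<otimes> t) = u \<otimes> (b \<otimes> s))"
  by (simp add: loc_rel_def)

lemma equiv_loc_rel: "equiv (carrier R \<times> S) (loc_rel R S)"
proof (rule equivI)
  show "loc_rel R S \<subseteq> (carrier R \<times> S) \<times> (carrier R \<times> S)"
    by (auto simp: loc_rel_def)
  show "refl_on (carrier R \<times> S) (loc_rel R S)"
    by (rule refl_onI) (auto simp: loc_rel_def)
  show "sym (loc_rel R S)"
    by (rule symI) (auto simp: loc_rel_def, metis)
  show "trans (loc_rel R S)"
  proof (rule transI)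
    fix x y z assume xy: "(x, y) \<in> loc_rel R S" and yz: "(y, z) \<in> loc_rel R S"
    obtain a s b t c r where x: "x = (a, s)" and y: "y = (b, t)" and z: "z = (c, r)"
      by (metis surj_pair)
    obtain u v where u: "u \<in> S" "u \<otimes> (a \<otimes> t) = u \<otimes> (b \<otimes> s)"
      and v: "v \<in> S" "v \<otimes> (b \<otimes> r) = v \<otimes> (c \<otimes> t)"
      and C: "a \<in> carrier R" "b \<in> carrier R" "c \<in> carrier R" "s \<in> S" "t \<in> S" "r \<in> S"
      using xy yz unfolding x y z loc_rel_iff by blast
    have "(u \<otimes> v \<otimes> t) \<otimes> (a \<otimes> r) = (u \<otimes> (a \<otimes> t)) \<otimes> (v \<otimes> r)"
      using u(1) v(1) C by (simp add: m_ac)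
    also have "\<dots> = (u \<otimes> s) \<otimes> (v \<otimes> (b \<otimes> r))"
      unfolding u(2) using u(1) v(1) C by (simp add: m_ac)
    also have "\<dots> = (u \<otimes> v \<otimes> t) \<otimes> (c \<otimes> s)"
      unfolding v(2) using u(1) v(1) C by (simp add: m_ac)
    finally have "(u \<otimes> v \<otimes> t) \<otimes> (a \<otimes> r) = (u \<otimes> v \<otimes> t) \<otimes> (c \<otimes> s)" .
    moreover have "u \<otimes> v \<otimes> t \<in> S" using u(1) v(1) C by simp
    ultimately show "(x, z) \<in> loc_rel R S"
      unfolding x z loc_rel_iff using C by blast
  qed
qed

lemma loc_frac_eq_iff:
  assumes "a \<in> carrier R" "s \<in> S" "b \<in> carrier R" "t \<in> S"
  shows "fr a s = fr b t \<longleftrightarrow> (\<exists>u \<in> S. u \<otimes> (a \<otimes> t) = u \<otimes> (b \<otimes> s))"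
  unfolding loc_frac_def using assms
  by (subst eq_equiv_class_iff [OF equiv_loc_rel]) (auto simp: loc_rel_iff)

lemma loc_frac_eqI:
  assumes "a \<in> carrier R" "s \<in> S" "b \<in> carrier R" "t \<in> S" "u \<in> S"
    "u \<otimes> (a \<otimes> t) = u \<otimes> (b \<otimes> s)"
  shows "fr a s = fr b t"
  using assms by (auto simp: loc_frac_eq_iff)

lemma loc_frac_closed [simp, intro]:
  "a \<in> carrier R \<Longrightarrow> s \<in> S \<Longrightarrow> fr a s \<in> carrier L"
  by (auto simp: localization_def loc_frac_def intro!: quotientI)

lemma loc_carrierE:
  assumes "x \<in> carrier L"
  obtains a s where "a \<in> carrier R" "s \<in> S" "x = fr a s"
  using assms by (auto simp: localization_def loc_frac_def elim!: quotientE)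

lemma loc_frac_cancel:
  assumes "a \<in> carrier R" "s \<in> S" "u \<in> S"
  shows "fr (u \<otimes> a) (u \<otimes> s) = fr a s"
  by (rule loc_frac_eqI [where u = \<one>]) (use assms in \<open>auto simp: m_ac\<close>)

lemma loc_frac_mult:
  assumes "a \<in> carrier R" "s \<in> S" "b \<in> carrier R" "t \<in> S"
  shows "fr a s \<otimes>\<^bsub>L\<^esub> fr b t = fr (a \<otimes> b) (s \<otimes> t)"
proof -
  have "(\<lambda>x y. case x of (a, s) \<Rightarrow> case y of (b, t) \<Rightarrow> fr (a \<otimes> b) (s \<otimes> t))
      respects2 loc_rel R S"
  proof (rule congruent2_commuteI [OF equiv_loc_rel])
    fix y z assume "y \<in> carrier R \<times> S" "z \<in> carrier R \<times> S"
    then show "(case y of (a, s) \<Rightarrow> case z of (b, t) \<Rightarrow> fr (a \<otimes> b) (s \<otimes> t)) =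
      (case z of (a, s) \<Rightarrow> case y of (b, t) \<Rightarrow> fr (a \<otimes> b) (s \<otimes> t))"
      by (auto simp: m_comm)
  next
    fix y z w assume w: "w \<in> carrier R \<times> S" and yz: "(y, z) \<in> loc_rel R S"
    obtain a s b t c r where e: "y = (a, s)" "z = (b, t)" "w = (c, r)"
      by (metis surj_pair)
    obtain u where u: "u \<in> S" "u \<otimes> (a \<otimes> t) = u \<otimes> (b \<otimes> s)"
      and C: "a \<in> carrier R" "b \<in> carrier R" "c \<in> carrier R" "s \<in> S" "t \<in> S" "r \<in> S"
      using w yz unfolding e loc_rel_iff by blast
    have "u \<otimes> ((c \<otimes> a) \<otimes> (r \<otimes> t)) = (c \<otimes> r) \<otimes> (u \<otimes> (a \<otimes> t))"
      using u(1) C by (simp add: m_ac)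
    also have "\<dots> = u \<otimes> ((c \<otimes> b) \<otimes> (r \<otimes> s))"
      unfolding u(2) using u(1) C by (simp add: m_ac)
    finally show "(case w of (a, s) \<Rightarrow> case y of (b, t) \<Rightarrow> fr (a \<otimes> b) (s \<otimes> t)) =
      (case w of (a, s) \<Rightarrow> case z of (b, t) \<Rightarrow> fr (a \<otimes> b) (s \<otimes> t))"
      unfolding e prod.case by (intro loc_frac_eqI [where u = u]) (use u(1) C in auto)
  qed
  from UN_equiv_class2 [OF equiv_loc_rel equiv_loc_rel this, of "(a, s)" "(b, t)"] assms
  show ?thesis by (simp add: localization_def loc_frac_def split_def)
qed

lemma loc_frac_add:
  assumes "a \<in> carrier R" "s \<in> S" "b \<in> carrier R" "t \<in> S"
  shows "fr a s \<oplus>\<^bsub>L\<^esub> fr b t = fr (a \<otimes> t \<oplus> b \<otimes> s) (s \<otimes> t)"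
proof -
  have "(\<lambda>x y. case x of (a, s) \<Rightarrow> case y of (b, t) \<Rightarrow> fr (a \<otimes> t \<oplus> b \<otimes> s) (s \<otimes> t))
      respects2 loc_rel R S"
  proof (rule congruent2_commuteI [OF equiv_loc_rel])
    fix y z assume "y \<in> carrier R \<times> S" "z \<in> carrier R \<times> S"
    then show "(case y of (a, s) \<Rightarrow> case z of (b, t) \<Rightarrow> fr (a \<otimes> t \<oplus> b \<otimes> s) (s \<otimes> t)) =
      (case z of (a, s) \<Rightarrow> case y of (b, t) \<Rightarrow> fr (a \<otimes> t \<oplus> b \<otimes> s) (s \<otimes> t))"
      by (auto simp: m_comm a_comm)
  next
    fix y z w assume w: "w \<in> carrier R \<times> S" and yz: "(y, z) \<in> loc_rel R S"
    obtain a s b t c r where e: "y = (a, s)" "z = (b, t)" "w = (c, r)"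
      by (metis surj_pair)
    obtain u where u: "u \<in> S" "u \<otimes> (a \<otimes> t) = u \<otimes> (b \<otimes> s)"
      and C: "a \<in> carrier R" "b \<in> carrier R" "c \<in> carrier R" "s \<in> S" "t \<in> S" "r \<in> S"
      using w yz unfolding e loc_rel_iff by blast
    have "u \<otimes> ((c \<otimes> s \<oplus> a \<otimes> r) \<otimes> (r \<otimes> t)) =
        u \<otimes> (c \<otimes> s \<otimes> (r \<otimes> t)) \<oplus> (r \<otimes> r) \<otimes> (u \<otimes> (a \<otimes> t))"
      using u(1) C by (simp add: l_distr r_distr m_ac)
    also have "\<dots> = u \<otimes> ((c \<otimes> t \<oplus> b \<otimes> r) \<otimes> (r \<otimes> s))"
      unfolding u(2) using u(1) C by (simp add: l_distr r_distr m_ac)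
    finally show "(case w of (a, s) \<Rightarrow> case y of (b, t) \<Rightarrow> fr (a \<otimes> t \<oplus> b \<otimes> s) (s \<otimes> t)) =
      (case w of (a, s) \<Rightarrow> case z of (b, t) \<Rightarrow> fr (a \<otimes> t \<oplus> b \<otimes> s) (s \<otimes> t))"
      unfolding e prod.case by (intro loc_frac_eqI [where u = u]) (use u(1) C in auto)
  qed
  from UN_equiv_class2 [OF equiv_loc_rel equiv_loc_rel this, of "(a, s)" "(b, t)"] assms
  show ?thesis by (simp add: localization_def loc_frac_def split_def)
qed

lemma loc_one: "\<one>\<^bsub>L\<^esub> = fr \<one> \<one>"
  and loc_zero: "\<zero>\<^bsub>L\<^esub> = fr \<zero> \<one>"
  by (simp_all add: localization_def)

lemma cring_localization: "cring L"
proof (rule cringI)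
  show "abelian_group L"
  proof (rule abelian_groupI)
    fix x y z assume "x \<in> carrier L" "y \<in> carrier L" "z \<in> carrier L"
    then show "x \<oplus>\<^bsub>L\<^esub> y \<oplus>\<^bsub>L\<^esub> z = x \<oplus>\<^bsub>L\<^esub> (y \<oplus>\<^bsub>L\<^esub> z)"
      by (elim loc_carrierE) (simp add: loc_frac_add l_distr r_distr m_ac a_ac)
  next
    fix x assume "x \<in> carrier L"
    then obtain a s where x: "a \<in> carrier R" "s \<in> S" "x = fr a s" by (rule loc_carrierE)
    have "fr (\<ominus> a) s \<oplus>\<^bsub>L\<^esub> x = fr \<zero> (s \<otimes> s)"
      using x by (simp add: loc_frac_add l_minus l_neg)
    also have "\<dots> = \<zero>\<^bsub>L\<^esub>"
      unfolding loc_zero by (rule loc_frac_eqI [where u = \<one>]) (use x in auto)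
    finally show "\<exists>y \<in> carrier L. y \<oplus>\<^bsub>L\<^esub> x = \<zero>\<^bsub>L\<^esub>"
      using x by blast
  qed (auto elim!: loc_carrierE simp: loc_frac_add loc_zero m_comm a_comm)
  show "comm_monoid L"
    by (rule comm_monoidI) (auto elim!: loc_carrierE simp: loc_frac_mult loc_one m_ac)
next
  fix x y z assume "x \<in> carrier L" "y \<in> carrier L" "z \<in> carrier L"
  then obtain a s b t c r
    where x: "a \<in> carrier R" "s \<in> S" "x = fr a s"
      and y: "b \<in> carrier R" "t \<in> S" "y = fr b t"
      and z: "c \<in> carrier R" "r \<in> S" "z = fr c r"
    by (metis loc_carrierE)
  have "(x \<oplus>\<^bsub>L\<^esub> y) \<otimes>\<^bsub>L\<^esub> z = fr ((a \<otimes> t \<oplus> b \<otimes> s) \<otimes> c) (s \<otimes> t \<otimes> r)"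
    using x y z by (simp add: loc_frac_add loc_frac_mult)
  also have "\<dots> = fr (r \<otimes> ((a \<otimes> t \<oplus> b \<otimes> s) \<otimes> c)) (r \<otimes> (s \<otimes> t \<otimes> r))"
    using x y z by (simp add: loc_frac_cancel)
  also have "\<dots> = x \<otimes>\<^bsub>L\<^esub> z \<oplus>\<^bsub>L\<^esub> y \<otimes>\<^bsub>L\<^esub> z"
    using x y z by (simp add: loc_frac_add loc_frac_mult l_distr r_distr m_ac)
  finally show "(x \<oplus>\<^bsub>L\<^esub> y) \<otimes>\<^bsub>L\<^esub> z = x \<otimes>\<^bsub>L\<^esub> z \<oplus>\<^bsub>L\<^esub> y \<otimes>\<^bsub>L\<^esub> z" .
qed

lemma loc_map_hom: "loc_map R S \<in> ring_hom R L"
  by (rule ring_hom_memI) (auto simp: loc_map_def loc_frac_add loc_frac_mult loc_one)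

end

definition localization_at :: "('a, 'm) ring_scheme \<Rightarrow> 'a set \<Rightarrow> ('a \<times> 'a) set ring"
  where "localization_at R M = localization R (carrier R - M)"

definition ideal_localization_at :: "('a, 'm) ring_scheme \<Rightarrow> 'a set \<Rightarrow> 'a set \<Rightarrow> ('a \<times> 'a) set set"
  where "ideal_localization_at R M I =
    Idl\<^bsub>localization_at R M\<^esub> (loc_map R (carrier R - M) ` I)"

lemma cring_mult_set_maximalideal:
  assumes "cring R" "maximalideal M R"
  shows "cring_mult_set R (carrier R - M)"
proof -
  interpret cring R by fact
  interpret primeideal M R using maximalideal_prime [OF assms(2)] .
  have "\<one>\<^bsub>R\<^esub> \<notin> M" using I_notcarr one_imp_carrier by metis
  then show ?thesis
    by unfold_locales (auto dest: I_prime)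
qed


section \<open>Locally principal ideals, content and Gaussian polynomials\<close>

definition locally_domain :: "('a, 'm) ring_scheme \<Rightarrow> bool"
  where "locally_domain R \<longleftrightarrow> (\<forall>M. maximalideal M R \<longrightarrow> domain (localization_at R M))"

definition locally_principal :: "('a, 'm) ring_scheme \<Rightarrow> 'a set \<Rightarrow> bool"
  where "locally_principal R I \<longleftrightarrow> ideal I R \<and>
    (\<forall>M. maximalideal M R \<longrightarrow>
       principalideal (ideal_localization_at R M I) (localization_at R M))"

definition content_ideal :: "('a, 'm) ring_scheme \<Rightarrow> (nat \<Rightarrow> 'a) \<Rightarrow> 'a set"
  where "content_ideal R f = Idl\<^bsub>R\<^esub> (coeff (UP R) f ` {..deg R f})"

definition gaussian_poly :: "('a, 'm) ring_scheme \<Rightarrow> (nat \<Rightarrow> 'a) \<Rightarrow> bool"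
  where "gaussian_poly R f \<longleftrightarrow> f \<in> carrier (UP R) \<and>
    (\<forall>g \<in> carrier (UP R).
       content_ideal R (f \<otimes>\<^bsub>UP R\<^esub> g) = content_ideal R f \<cdot>\<^bsub>R\<^esub> content_ideal R g)"

end

theory Submission
  imports Defs
begin

text \<open>
  Write \<open>c(g)\<close> for the content of \<open>g\<close>. One direction holds because, locally at a maximal ideal
  \<open>M\<close>, a polynomial with nonzero principal content \<open>(d)\<close> is \<open>d\<close> times a polynomial \<open>p\<close>
  with some coefficient outside \<open>M\<close>, and multiplication by such a \<open>p\<close> does not change contents
  (\<open>coeff_in_saturation_content_mult\<close>, \<open>gaussian_if_content_locally_principal\<close>).

  For the converse let \<open>f\<close> be Gaussian of degree \<open>n\<close>, so that \<open>c(f\<^sup>k) = c(f)\<^sup>k\<close>. It is enough to find, at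
  each \<open>M\<close> where \<open>c(f)\<close> does not vanish, an equation \<open>z s = f g\<close> with \<open>z \<in> R\<close> nonzero in \<open>R\<^sub>M\<close>
  and \<open>s \<notin> M[X]\<close>: it gives \<open>c(f) c(g) = z c(s)\<close>, which is \<open>(z)\<close> at \<open>M\<close>, and since \<open>R\<^sub>M\<close> is a local domain \<open>c(f)\<close> becomes
  invertible and therefore principal (\<open>content_locally_principal_if_gaussian\<close>).

  Such equations come from a bound on numbers of generators. If \<open>F(X\<^sup>2) = f(X) f(-X)\<close>, then \<open>F\<close> is
  again Gaussian of degree at most \<open>n\<close>, with \<open>c(F) = c(f)\<^sup>2\<close> (\<open>gaussian_square\<close>). Hence
  \<open>c(f)\<^sup>m\<close> is generated by \<open>n + 1\<close> elements for every \<open>m\<close> that is a power of 2. Choose such an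
  \<open>m > n\<close>. Any \<open>n + 2\<close> polynomials \<open>f\<^bsup>m-i\<^esup> w\<^sub>i\<close> with \<open>w\<^sub>i \<in> c(f)\<^sup>i\<close>, \<open>0 \<le> i \<le> n + 1\<close>, are then dependent
  modulo \<open>M c(f)\<^sup>m\<close> over the field of rational functions of \<open>R/M\<close>. By the Gaussian property the
  power of \<open>f\<close> common to the terms of such a relation can be traded for an element of the
  corresponding power of \<open>c(f)\<close>, and what remains says that \<open>c(f)\<^sup>m\<close> is contained in
  \<open>f R[X] + M c(f)\<^sup>m R[X]\<close> after localizing \<open>R[X]\<close> at \<open>M[X]\<close>
  (\<open>gaussian_power_in_saturation\<close>). Nakayama's lemma removes the second summand
  (\<open>gaussian_power_locally_multiple\<close>).
\<close>


section \<open>Ideals and saturation at a prime ideal\<close>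

text \<open>
  Contraction to \<open>R\<close> of the extension of \<open>N\<close> to the localization at \<open>P\<close>. Statements about
  \<open>R\<^sub>P\<close> are phrased through it, which keeps every computation in \<open>R\<close> or \<open>R[X]\<close>; for
  \<open>N = 0\<close> it is the kernel of \<open>R \<rightarrow> R\<^sub>P\<close>.
\<close>

definition saturation :: "('a, 'm) ring_scheme \<Rightarrow> 'a set \<Rightarrow> 'a set \<Rightarrow> 'a set"
  where "saturation R P N =
    {x \<in> carrier R. \<exists>s \<in> carrier R - P. s \<otimes>\<^bsub>R\<^esub> x \<in> N}"

context cring
begin

lemma idealI_comm:
  assumes "J \<subseteq> carrier R" "\<zero> \<in> J" "\<And>x y. x \<in> J \<Longrightarrow> y \<in> J \<Longrightarrow> x \<oplus> y \<in> J"
    and l: "\<And>r x. r \<in> carrier R \<Longrightarrow> x \<in> J \<Longrightarrow> r \<otimes> x \<in> J"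
  shows "ideal J R"
proof (rule idealI [OF ring_axioms])
  show "subgroup J (add_monoid R)"
  proof (rule add.subgroupI)
    fix x assume x: "x \<in> J"
    then have "\<ominus> x = (\<ominus> \<one>) \<otimes> x" using assms(1) by (auto simp: l_minus)
    then show "\<ominus> x \<in> J" using l x by simp
  qed (use assms in auto)
next
  fix a x assume "a \<in> J" "x \<in> carrier R"
  then show "x \<otimes> a \<in> J" "a \<otimes> x \<in> J"
    using l [of x a] assms(1) by (auto simp: m_comm [of a x])
qed

lemma ideal_closed:
  assumes "ideal J R"
  shows ideal_zero: "\<zero> \<in> J"
    and ideal_carr: "x \<in> J \<Longrightarrow> x \<in> carrier R"
    and ideal_add: "x \<in> J \<Longrightarrow> y \<in> J \<Longrightarrow> x \<oplus> y \<in> J"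
    and ideal_minus: "x \<in> J \<Longrightarrow> y \<in> J \<Longrightarrow> x \<ominus> y \<in> J"
    and ideal_l: "x \<in> J \<Longrightarrow> r \<in> carrier R \<Longrightarrow> r \<otimes> x \<in> J"
    and ideal_r: "x \<in> J \<Longrightarrow> r \<in> carrier R \<Longrightarrow> x \<otimes> r \<in> J"
proof -
  interpret ideal J R by fact
  show "\<zero> \<in> J" by simp
  show "x \<in> J \<Longrightarrow> x \<in> carrier R" by (rule Icarr)
  show "x \<in> J \<Longrightarrow> y \<in> J \<Longrightarrow> x \<oplus> y \<in> J" by simp
  show "x \<in> J \<Longrightarrow> y \<in> J \<Longrightarrow> x \<ominus> y \<in> J" by (simp add: a_minus_def)
  show "x \<in> J \<Longrightarrow> r \<in> carrier R \<Longrightarrow> r \<otimes> x \<in> J" by (rule I_l_closed)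
  show "x \<in> J \<Longrightarrow> r \<in> carrier R \<Longrightarrow> x \<otimes> r \<in> J" by (rule I_r_closed)
qed

lemma add_minus_cancel: "x \<in> carrier R \<Longrightarrow> y \<in> carrier R \<Longrightarrow> (x \<oplus> y) \<ominus> y = x"
  by (simp add: a_minus_def a_assoc r_neg)

lemma ideal_mem_if_diff_mem:
  assumes J: "ideal J R" and "z \<in> J" "z \<ominus> w \<in> J" "w \<in> carrier R"
  shows "w \<in> J"
proof -
  have "z \<ominus> (z \<ominus> w) = w"
    using assms(4) ideal_carr [OF J assms(2)]
    by (simp add: a_minus_def minus_add a_assoc [symmetric] r_neg)
  then show ?thesis using ideal_minus [OF J assms(2,3)] by simp
qed

lemma ideal_finsum:
  assumes "ideal J R" "finite A" "\<And>i. i \<in> A \<Longrightarrow> x i \<in> J"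
  shows "(\<Oplus>i\<in>A. x i) \<in> J"
  using assms(2,3)
proof (induction A rule: finite_induct)
  case empty
  then show ?case using ideal_zero [OF assms(1)] by simp
next
  case (insert i A)
  then have "x \<in> A \<rightarrow> carrier R" "x i \<in> carrier R"
    using ideal_carr [OF assms(1)] by auto
  then show ?case using insert ideal_add [OF assms(1)] by simp
qed

lemma ideal_preimage_mult:
  assumes "ideal J R" "c \<in> carrier R"
  shows "ideal {x \<in> carrier R. c \<otimes> x \<in> J} R"
proof (rule idealI_comm)
  fix r x assume "r \<in> carrier R" "x \<in> {x \<in> carrier R. c \<otimes> x \<in> J}"
  then show "r \<otimes> x \<in> {x \<in> carrier R. c \<otimes> x \<in> J}"
    using ideal_l [OF assms(1), of "c \<otimes> x" r] assms(2) by (simp add: m_lcomm)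
qed (use assms in \<open>auto simp: r_distr ideal_zero ideal_add\<close>)

lemma ideal_prod_subset:
  assumes "ideal K R" "\<And>i j. i \<in> I \<Longrightarrow> j \<in> J \<Longrightarrow> i \<otimes> j \<in> K"
  shows "I \<cdot> J \<subseteq> K"
proof
  fix x assume "x \<in> I \<cdot> J"
  then show "x \<in> K"
    by induction (use assms ideal_add in auto)
qed

lemma prime_mult:
  assumes "primeideal P R" "x \<in> carrier R - P" "y \<in> carrier R - P"
  shows "x \<otimes> y \<in> carrier R - P"
  using assms primeideal.I_prime by fastforce

lemma prime_one:
  assumes "primeideal P R"
  shows "\<one> \<in> carrier R - P"
  using assms ideal.one_imp_carrier primeideal.I_notcarr primeideal.axioms(1) by fastforce

lemma saturation_carr: "saturation R P N \<subseteq> carrier R"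
  by (auto simp: saturation_def)

lemma subset_saturation:
  assumes "primeideal P R" "ideal N R"
  shows "N \<subseteq> saturation R P N"
proof
  fix x assume x: "x \<in> N"
  with ideal_carr assms have "x \<in> carrier R" by blast
  then show "x \<in> saturation R P N"
    using prime_one [OF assms(1)] x by (auto simp: saturation_def intro!: bexI [of _ \<one>])
qed

lemma saturation_mono: "N \<subseteq> N' \<Longrightarrow> saturation R P N \<subseteq> saturation R P N'"
  by (auto simp: saturation_def)

lemma saturationI:
  "x \<in> carrier R \<Longrightarrow> s \<in> carrier R - P \<Longrightarrow> s \<otimes> x \<in> N \<Longrightarrow> x \<in> saturation R P N"
  by (auto simp: saturation_def)

lemma ideal_saturation:
  assumes P: "primeideal P R" and N: "ideal N R"
  shows "ideal (saturation R P N) R"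
proof (rule idealI_comm)
  show "\<zero> \<in> saturation R P N"
    using subset_saturation [OF P N] ideal_zero [OF N] by blast
next
  fix x y assume "x \<in> saturation R P N" "y \<in> saturation R P N"
  then obtain s t where st: "s \<in> carrier R - P" "s \<otimes> x \<in> N" "t \<in> carrier R - P" "t \<otimes> y \<in> N"
    and c: "x \<in> carrier R" "y \<in> carrier R"
    by (auto simp: saturation_def)
  have "(s \<otimes> t) \<otimes> (x \<oplus> y) = t \<otimes> (s \<otimes> x) \<oplus> s \<otimes> (t \<otimes> y)"
    using st c by (simp add: r_distr m_ac)
  also have "\<dots> \<in> N" using st by (auto intro!: ideal_add [OF N] ideal_l [OF N])
  finally show "x \<oplus> y \<in> saturation R P N"
    using c by (intro saturationI [OF _ prime_mult [OF P st(1,3)]]) auto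
next
  fix r x assume r: "r \<in> carrier R" and "x \<in> saturation R P N"
  then obtain s where s: "s \<in> carrier R - P" "s \<otimes> x \<in> N" and c: "x \<in> carrier R"
    by (auto simp: saturation_def)
  have "s \<otimes> (r \<otimes> x) \<in> N"
    using ideal_l [OF N s(2) r] s(1) c r by (simp add: m_lcomm)
  then show "r \<otimes> x \<in> saturation R P N"
    using c r s by (intro saturationI) auto
qed (rule saturation_carr)

lemma saturation_cancel:
  assumes "primeideal P R" "x \<in> carrier R" "s \<in> carrier R - P" "s \<otimes> x \<in> saturation R P N"
  shows "x \<in> saturation R P N"
proof -
  obtain t where t: "t \<in> carrier R - P" "t \<otimes> (s \<otimes> x) \<in> N"
    using assms(4) by (auto simp: saturation_def)
  then have "(t \<otimes> s) \<otimes> x \<in> N" using assms by (simp add: m_assoc)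
  then show ?thesis using assms(2) prime_mult [OF assms(1) t(1) assms(3)] by (rule_tac saturationI)
qed

lemma saturation_idem:
  assumes "primeideal P R"
  shows "saturation R P (saturation R P N) \<subseteq> saturation R P N"
  using saturation_cancel [OF assms] by (auto simp: saturation_def [of R P "saturation R P N"])

lemma saturation_common_denominator:
  assumes P: "primeideal P R" and N: "ideal N R" and "finite A"
    and "\<And>i. i \<in> A \<Longrightarrow> x i \<in> saturation R P N"
  obtains s where "s \<in> carrier R - P" "\<forall>i \<in> A. s \<otimes> x i \<in> N"
proof -
  have "\<exists>s \<in> carrier R - P. \<forall>i \<in> A. s \<otimes> x i \<in> N"
    using assms(3,4)
  proof (induction A rule: finite_induct)
    case empty
    then show ?case using prime_one [OF P] by blast
  next
    case (insert j A)
    then obtain s t where s: "s \<in> carrier R - P" "\<forall>i \<in> A. s \<otimes> x i \<in> N"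
      and t: "t \<in> carrier R - P" "t \<otimes> x j \<in> N"
      unfolding saturation_def by blast
    have c: "i \<in> insert j A \<Longrightarrow> x i \<in> carrier R" for i
      using insert.prems saturation_carr by blast
    have "(s \<otimes> t) \<otimes> x i \<in> N" if "i \<in> insert j A" for i
    proof (cases "i = j")
      case True
      then show ?thesis
        using ideal_l [OF N t(2), of s] s(1) t(1) c [OF that] by (simp add: m_assoc)
    next
      case False
      then have "s \<otimes> x i \<in> N" using that s(2) by blast
      from ideal_l [OF N this, of t] show ?thesis
        using s(1) t(1) c [OF that] by (simp add: m_ac)
    qed
    then show ?case using prime_mult [OF P s(1) t(1)] by blast
  qed
  then show thesis using that by blast
qed

text \<open>
  Nakayama over \<open>R\<^sub>P\<close> for the module generated by the \<open>w\<^sub>l\<close>. The hypothesis ranges over all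
  ideals \<open>N \<supseteq> Q\<close> containing every \<open>P w\<^sub>l\<close>; the least such \<open>N\<close> is \<open>Q + \<Sum> P w\<^sub>l\<close>, and the
  quantified form spares writing that sum. Generators are removed one at a time: with
  \<open>P w\<^sub>a\<close> absorbed into \<open>Q\<close> the other generators are handled by induction, and what is left is a
  relation \<open>s w\<^sub>a = x + p w\<^sub>a\<close> with \<open>x \<in> Q\<close>, where \<open>s - p\<close> is again outside \<open>P\<close>.
\<close>

lemma nakayama:
  assumes P: "primeideal P R" and "finite A" and "ideal Q R"
    and "\<And>i. i \<in> A \<Longrightarrow> w i \<in> carrier R"
    and "\<And>N i. ideal N R \<Longrightarrow> Q \<subseteq> N \<Longrightarrow> (\<And>p l. p \<in> P \<Longrightarrow> l \<in> A \<Longrightarrow> p \<otimes> w l \<in> N) \<Longrightarrow>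
      i \<in> A \<Longrightarrow> w i \<in> saturation R P N"
    and "i \<in> A"
  shows "w i \<in> saturation R P Q"
proof -
  have "\<forall>i \<in> A. w i \<in> saturation R P Q"
    using assms(2-5)
  proof (induction A arbitrary: Q rule: finite_induct)
    case empty
    then show ?case by simp
  next
    case (insert a A)
    have Pid: "ideal P R" using P by (rule primeideal.axioms)
    have wc: "w i \<in> carrier R" if "i \<in> insert a A" for i
      using insert.prems(2) that by blast
    define Q' where "Q' = {x \<oplus> p \<otimes> w a | x p. x \<in> Q \<and> p \<in> P}"
    have Q'I: "x \<oplus> p \<otimes> w a \<in> Q'" if "x \<in> Q" "p \<in> P" for x p
      using that by (auto simp: Q'_def)
    note Qc = ideal_carr [OF insert.prems(1)] and Pc = ideal_carr [OF Pid]
    have Q': "ideal Q' R"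
    proof (rule idealI_comm)
      show "Q' \<subseteq> carrier R" using Qc Pc wc by (auto simp: Q'_def)
      show "\<zero> \<in> Q'"
        using Q'I [OF ideal_zero [OF insert.prems(1)] ideal_zero [OF Pid]] wc by simp
    next
      fix y z assume "y \<in> Q'" "z \<in> Q'"
      then obtain x p x' p' where e: "y = x \<oplus> p \<otimes> w a" "z = x' \<oplus> p' \<otimes> w a"
        and m: "x \<in> Q" "p \<in> P" "x' \<in> Q" "p' \<in> P"
        by (auto simp: Q'_def)
      have "y \<oplus> z = (x \<oplus> x') \<oplus> (p \<oplus> p') \<otimes> w a"
        unfolding e using m Qc Pc wc by (simp add: l_distr a_ac)
      then show "y \<oplus> z \<in> Q'"
        using Q'I ideal_add [OF insert.prems(1)] ideal_add [OF Pid] m by simp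
    next
      fix r y assume r: "r \<in> carrier R" and "y \<in> Q'"
      then obtain x p where e: "y = x \<oplus> p \<otimes> w a" and m: "x \<in> Q" "p \<in> P"
        by (auto simp: Q'_def)
      have "r \<otimes> y = r \<otimes> x \<oplus> (r \<otimes> p) \<otimes> w a"
        unfolding e using m Qc Pc wc r by (simp add: r_distr m_assoc)
      then show "r \<otimes> y \<in> Q'"
        using Q'I ideal_l [OF insert.prems(1)] ideal_l [OF Pid] m r by simp
    qed
    have QQ': "Q \<subseteq> Q'"
    proof
      fix x assume "x \<in> Q"
      then show "x \<in> Q'" using Q'I [OF _ ideal_zero [OF Pid], of x] wc Qc by simp
    qed
    have PQ': "p \<otimes> w a \<in> Q'" if "p \<in> P" for p
      using Q'I [OF ideal_zero [OF insert.prems(1)] that] wc Pc that by simp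
    have A: "\<forall>i \<in> A. w i \<in> saturation R P Q'"
    proof (rule insert.IH [OF Q'])
      fix N i
      assume "ideal N R" "Q' \<subseteq> N" "\<And>p l. p \<in> P \<Longrightarrow> l \<in> A \<Longrightarrow> p \<otimes> w l \<in> N" "i \<in> A"
      then show "w i \<in> saturation R P N"
        using QQ' PQ' by (intro insert.prems(3)) auto
    qed (use wc in blast)
    have S': "ideal (saturation R P Q') R" by (rule ideal_saturation [OF P Q'])
    have "w a \<in> saturation R P (saturation R P Q')"
    proof (rule insert.prems(3) [OF S'])
      show "Q \<subseteq> saturation R P Q'" using QQ' subset_saturation [OF P Q'] by blast
      fix p l assume "p \<in> P" "l \<in> insert a A"
      then show "p \<otimes> w l \<in> saturation R P Q'"
        using PQ' subset_saturation [OF P Q'] A ideal_l [OF S'] Pc by blast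
    qed simp
    then have "w a \<in> saturation R P Q'" using saturation_idem [OF P] by blast
    then obtain s x p where s: "s \<in> carrier R - P" "s \<otimes> w a = x \<oplus> p \<otimes> w a" "x \<in> Q" "p \<in> P"
      by (auto simp: saturation_def Q'_def)
    have c: "s \<in> carrier R" "x \<in> carrier R" "p \<in> carrier R" "w a \<in> carrier R"
      using s Qc Pc wc by auto
    have "(s \<ominus> p) \<otimes> w a = s \<otimes> w a \<ominus> p \<otimes> w a"
      using c by (simp add: a_minus_def l_distr l_minus)
    also have "\<dots> = x" unfolding s(2) using c by (simp add: a_minus_def a_assoc r_neg)
    finally have x: "(s \<ominus> p) \<otimes> w a \<in> Q" using s(3) by simp
    have "s \<ominus> p \<notin> P"
    proof
      assume "s \<ominus> p \<in> P"
      from ideal_add [OF Pid this s(4)] have "s \<in> P"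
        using c by (simp add: a_minus_def a_assoc l_neg)
      with s(1) show False by simp
    qed
    then have wa: "w a \<in> saturation R P Q"
      using x c by (intro saturationI [of _ "s \<ominus> p"]) auto
    have S: "ideal (saturation R P Q) R" by (rule ideal_saturation [OF P insert.prems(1)])
    have "Q' \<subseteq> saturation R P Q"
      using subset_saturation [OF P insert.prems(1)] wa Pc
      by (auto simp: Q'_def intro!: ideal_add [OF S] ideal_l [OF S])
    then have "saturation R P Q' \<subseteq> saturation R P Q"
      using saturation_mono saturation_idem [OF P] by blast
    then show ?case using wa A by blast
  qed
  then show ?thesis using assms(6) by blast
qed

lemma ideal_scale:
  assumes J: "ideal J R" and z: "z \<in> carrier R"
  shows "ideal {z \<otimes> r | r. r \<in> J} R"
proof (rule idealI_comm)
  show "{z \<otimes> r | r. r \<in> J} \<subseteq> carrier R" using ideal_carr [OF J] z by auto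
  show "\<zero> \<in> {z \<otimes> r | r. r \<in> J}" using ideal_zero [OF J] z by force
next
  fix x y assume "x \<in> {z \<otimes> r | r. r \<in> J}" "y \<in> {z \<otimes> r | r. r \<in> J}"
  then obtain r r' where r: "r \<in> J" "r' \<in> J" "x = z \<otimes> r" "y = z \<otimes> r'" by blast
  then have "x \<oplus> y = z \<otimes> (r \<oplus> r')" using ideal_carr [OF J] z by (simp add: r_distr)
  then show "x \<oplus> y \<in> {z \<otimes> r | r. r \<in> J}" using ideal_add [OF J] r by blast
next
  fix c x assume c: "c \<in> carrier R" and "x \<in> {z \<otimes> r | r. r \<in> J}"
  then obtain r where r: "r \<in> J" "x = z \<otimes> r" by blast
  then have "c \<otimes> x = z \<otimes> (c \<otimes> r)" using ideal_carr [OF J] z c by (simp add: m_lcomm)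
  then show "c \<otimes> x \<in> {z \<otimes> r | r. r \<in> J}" using ideal_l [OF J] r c by blast
qed

text \<open>
  Nakayama for a cyclic module: \<open>t z = z r\<close> with \<open>r \<in> M\<close> and \<open>t \<notin> M\<close> means that \<open>t - r\<close>, which
  lies outside \<open>M\<close>, kills \<open>z\<close>.
\<close>

lemma mem_saturation_zero_if_mem_saturation_scale:
  assumes M: "primeideal M R" and z: "z \<in> saturation R M {z \<otimes> r | r. r \<in> M}"
  shows "z \<in> saturation R M {\<zero>}"
proof -
  have Mid: "ideal M R" using M by (rule primeideal.axioms)
  obtain t r where t: "t \<in> carrier R - M" "t \<otimes> z = z \<otimes> r" "r \<in> M" and zc: "z \<in> carrier R"
    using z unfolding saturation_def by blast
  note rc = ideal_carr [OF Mid t(3)]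
  have "(t \<ominus> r) \<otimes> z = t \<otimes> z \<ominus> r \<otimes> z"
    using t(1) rc zc by (simp add: a_minus_def l_distr l_minus)
  also have "\<dots> = \<zero>" unfolding t(2) using rc zc by (simp add: a_minus_def m_comm r_neg)
  finally have "(t \<ominus> r) \<otimes> z = \<zero>" .
  moreover have "t \<ominus> r \<notin> M"
  proof
    assume "t \<ominus> r \<in> M"
    from ideal_add [OF Mid this t(3)] have "t \<in> M"
      using t(1) rc by (simp add: a_minus_def a_assoc l_neg)
    with t(1) show False by simp
  qed
  ultimately show ?thesis using t(1) rc zc by (intro saturationI [of _ "t \<ominus> r"]) auto
qed

text \<open>
  A matrix with more rows than columns has dependent rows over the fraction field of \<open>R/P\<close>;
  clearing denominators gives coefficients in \<open>R\<close>, not all in \<open>P\<close>. The proof is fraction-free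
  elimination of the last column by a pivot outside \<open>P\<close>. An arbitrary index set for the rows
  allows the pivot row to be discarded wherever it stands.
\<close>

lemma dependent_rows_mod_prime:
  fixes B :: "'i \<Rightarrow> nat \<Rightarrow> 'a"
  assumes P: "primeideal P R" and "finite A" "card A > n"
    and "\<And>i l. i \<in> A \<Longrightarrow> B i l \<in> carrier R"
  shows "\<exists>u. (\<forall>i \<in> A. u i \<in> carrier R) \<and> (\<exists>i \<in> A. u i \<notin> P) \<and>
    (\<forall>l < n. (\<Oplus>i\<in>A. u i \<otimes> B i l) \<in> P)"
  using assms(2-4)
proof (induction n arbitrary: A B)
  case 0
  then obtain a where "a \<in> A" by (metis card_gt_0_iff ex_in_conv)
  then show ?case using prime_one [OF P] by (intro exI [of _ "\<lambda>i. \<one>"]) auto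
next
  case (Suc n)
  have Pid: "ideal P R" using P by (rule primeideal.axioms)
  show ?case
  proof (cases "\<forall>i \<in> A. B i n \<in> P")
    case True
    obtain u where u: "\<forall>i \<in> A. u i \<in> carrier R" "\<exists>i \<in> A. u i \<notin> P"
      "\<forall>l < n. (\<Oplus>i\<in>A. u i \<otimes> B i l) \<in> P"
      using Suc.IH [of A B] Suc.prems by auto
    have "(\<Oplus>i\<in>A. u i \<otimes> B i n) \<in> P"
      using True u(1) Suc.prems by (intro ideal_finsum [OF Pid] ideal_l [OF Pid]) auto
    then show ?thesis using u by (auto simp: less_Suc_eq intro!: exI [of _ u])
  next
    case False
    then obtain a where a: "a \<in> A" "B a n \<notin> P" by blast
    define A' where "A' = A - {a}"
    have A': "finite A'" "a \<notin> A'" "A = insert a A'" "card A' > n"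
      using a Suc.prems by (auto simp: A'_def)
    have Ba: "B a l \<in> carrier R" for l using Suc.prems a by blast
    have Bi: "i \<in> A' \<Longrightarrow> B i l \<in> carrier R" for i l using Suc.prems A' by blast
    define B' where "B' i l = B a n \<otimes> B i l \<ominus> B i n \<otimes> B a l" for i l
    obtain v where v: "\<forall>i \<in> A'. v i \<in> carrier R" "\<exists>i \<in> A'. v i \<notin> P"
      "\<forall>l < n. (\<Oplus>i\<in>A'. v i \<otimes> B' i l) \<in> P"
      using Suc.IH [of A' B'] A' Ba Bi by (auto simp: B'_def)
    define t where "t = \<ominus> (\<Oplus>i\<in>A'. v i \<otimes> B i n)"
    have tc: "t \<in> carrier R" unfolding t_def using v(1) Bi by (auto intro!: a_inv_closed finsum_closed)
    define u where "u i = (if i = a then t else B a n \<otimes> v i)" for i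
    have *: "(\<Oplus>i\<in>A. u i \<otimes> B i l) = (\<Oplus>i\<in>A'. v i \<otimes> B' i l)" for l
    proof -
      have "(\<Oplus>i\<in>A. u i \<otimes> B i l) = t \<otimes> B a l \<oplus> (\<Oplus>i\<in>A'. u i \<otimes> B i l)"
        unfolding A'(3) using A'(1,2) tc Ba Bi v(1)
        by (subst finsum_insert) (auto simp: u_def)
      also have "(\<Oplus>i\<in>A'. u i \<otimes> B i l) = (\<Oplus>i\<in>A'. v i \<otimes> (B a n \<otimes> B i l))"
        using A'(2) Ba Bi v(1) by (intro finsum_cong') (auto simp: u_def m_ac)
      also have "t \<otimes> B a l = (\<Oplus>i\<in>A'. v i \<otimes> (\<ominus> (B i n \<otimes> B a l)))"
      proof -
        have "t \<otimes> B a l = (\<Oplus>i\<in>A'. v i \<otimes> B i n) \<otimes> (\<ominus> B a l)"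
          unfolding t_def using v(1) Bi Ba by (simp add: l_minus r_minus finsum_closed Pi_def)
        also have "\<dots> = (\<Oplus>i\<in>A'. v i \<otimes> B i n \<otimes> (\<ominus> B a l))"
          using v(1) Bi Ba A'(1) by (subst finsum_ldistr) (auto simp: Pi_def)
        also have "\<dots> = (\<Oplus>i\<in>A'. v i \<otimes> (\<ominus> (B i n \<otimes> B a l)))"
          using v(1) Bi Ba by (intro finsum_cong') (auto simp: m_assoc r_minus)
        finally show ?thesis .
      qed
      also have "(\<Oplus>i\<in>A'. v i \<otimes> (\<ominus> (B i n \<otimes> B a l))) \<oplus> (\<Oplus>i\<in>A'. v i \<otimes> (B a n \<otimes> B i l)) =
          (\<Oplus>i\<in>A'. v i \<otimes> (\<ominus> (B i n \<otimes> B a l)) \<oplus> v i \<otimes> (B a n \<otimes> B i l))"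
        using v(1) Bi Ba by (subst finsum_addf) (auto simp: Pi_def)
      also have "\<dots> = (\<Oplus>i\<in>A'. v i \<otimes> B' i l)"
        using v(1) Bi Ba
        by (intro finsum_cong') (auto simp: B'_def a_minus_def r_distr a_comm)
      finally show ?thesis .
    qed
    have "B' i n = \<zero>" if "i \<in> A'" for i
      using Ba Bi [OF that] by (simp add: B'_def m_comm [of "B a n"] a_minus_def r_neg)
    then have "(\<Oplus>i\<in>A'. v i \<otimes> B' i n) = (\<Oplus>i\<in>A'. \<zero>)"
      using v(1) by (intro finsum_cong') auto
    then have "(\<Oplus>i\<in>A'. v i \<otimes> B' i n) \<in> P" using ideal_zero [OF Pid] by simp
    then have "\<forall>l < Suc n. (\<Oplus>i\<in>A. u i \<otimes> B i l) \<in> P"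
      using v(3) * by (auto simp: less_Suc_eq)
    moreover have "\<forall>i \<in> A. u i \<in> carrier R" using tc v(1) Ba A'(3) by (auto simp: u_def)
    moreover have "\<exists>i \<in> A. u i \<notin> P"
    proof -
      obtain i where i: "i \<in> A'" "v i \<notin> P" using v(2) by blast
      have "B a n \<otimes> v i \<notin> P" using prime_mult [OF P, of "B a n" "v i"] a Ba i v(1) by blast
      then have "u i \<notin> P" using i A'(2) by (auto simp: u_def)
      then show ?thesis using i A'(3) by blast
    qed
    ultimately show ?thesis by (intro exI [of _ u]) simp
  qed
qed

lemma exists_maximalideal_supset:
  assumes I: "ideal I R" and one: "\<one> \<notin> I"
  obtains M where "maximalideal M R" "I \<subseteq> M"
proof -
  let ?C = "{J. ideal J R \<and> I \<subseteq> J \<and> \<one> \<notin> J}"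
  have "\<exists>M \<in> ?C. \<forall>X \<in> ?C. M \<subseteq> X \<longrightarrow> X = M"
  proof (rule subset_Zorn_nonempty)
    show "?C \<noteq> {}" using I one by blast
    fix C assume ne: "C \<noteq> {}" and ch: "subset.chain ?C C"
    have C: "J \<in> C \<Longrightarrow> ideal J R \<and> I \<subseteq> J \<and> \<one> \<notin> J" for J
      using ch by (auto simp: subset.chain_def)
    have tot: "J \<in> C \<Longrightarrow> K \<in> C \<Longrightarrow> J \<subseteq> K \<or> K \<subseteq> J" for J K
      using ch by (auto simp: subset.chain_def)
    have "ideal (\<Union>C) R"
    proof (rule idealI_comm)
      show "\<Union>C \<subseteq> carrier R" using C ideal_carr by blast
      show "\<zero> \<in> \<Union>C" using ne C ideal_zero by blast
      fix x y assume "x \<in> \<Union>C" "y \<in> \<Union>C"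
      then obtain J K where "J \<in> C" "K \<in> C" "x \<in> J" "y \<in> K" by blast
      then show "x \<oplus> y \<in> \<Union>C"
        using tot [of J K] C ideal_add by blast
    next
      fix r x assume "r \<in> carrier R" "x \<in> \<Union>C"
      then show "r \<otimes> x \<in> \<Union>C" using C ideal_l by blast
    qed
    then show "\<Union>C \<in> ?C" using C ne by blast
  qed
  then obtain M where MC: "M \<in> ?C" and max: "\<forall>X \<in> ?C. M \<subseteq> X \<longrightarrow> X = M"
    by (rule bexE)
  then have M: "ideal M R" "I \<subseteq> M" "\<one> \<notin> M" by simp_all
  have "maximalideal M R"
  proof (rule maximalidealI [OF M(1)])
    show "carrier R \<noteq> M" using M(3) by auto
    fix J assume "ideal J R" "M \<subseteq> J" "J \<subseteq> carrier R"
    then show "J = M \<or> J = carrier R"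
      using max [rule_format, of J] M(2) ideal.one_imp_carrier [of J R] by auto
  qed
  then show thesis using that M(2) by blast
qed

text \<open>
  Otherwise the multipliers carrying \<open>x\<close> into \<open>N\<close> form a proper ideal, contained in some
  maximal ideal, at which \<open>x\<close> fails to be locally in \<open>N\<close>.
\<close>

lemma mem_ideal_if_locally_mem:
  assumes N: "ideal N R" and x: "x \<in> carrier R"
    and loc: "\<And>M. maximalideal M R \<Longrightarrow> x \<in> saturation R M N"
  shows "x \<in> N"
proof (rule ccontr)
  assume "x \<notin> N"
  let ?D = "{s \<in> carrier R. x \<otimes> s \<in> N}"
  have "ideal ?D R" by (rule ideal_preimage_mult [OF N x])
  moreover have "\<one> \<notin> ?D" using \<open>x \<notin> N\<close> x by simp
  ultimately obtain M where M: "maximalideal M R" "?D \<subseteq> M"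
    by (rule exists_maximalideal_supset)
  obtain s where "s \<in> carrier R - M" "s \<otimes> x \<in> N"
    using loc [OF M(1)] by (auto simp: saturation_def)
  then have "s \<in> ?D" using x by (simp add: m_comm)
  then show False using M(2) \<open>s \<in> carrier R - M\<close> by blast
qed

end


section \<open>Polynomials with coefficients in an ideal, and contents\<close>

definition coeffs_in :: "('a, 'm) ring_scheme \<Rightarrow> 'a set \<Rightarrow> (nat \<Rightarrow> 'a) set"
  where "coeffs_in R J = {p \<in> carrier (UP R). \<forall>i. coeff (UP R) p i \<in> J}"

context UP_cring
begin

lemma coeffs_in_iff: "p \<in> coeffs_in R J \<longleftrightarrow> p \<in> carrier P \<and> (\<forall>i. coeff P p i \<in> J)"
  by (simp add: coeffs_in_def P_def)

lemma ideal_coeffs_in: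
  assumes J: "ideal J R"
  shows "ideal (coeffs_in R J) P"
proof (rule P.idealI_comm)
  fix r x assume "r \<in> carrier P" "x \<in> coeffs_in R J"
  then show "r \<otimes>\<^bsub>P\<^esub> x \<in> coeffs_in R J"
    by (auto simp: coeffs_in_iff intro!: R.ideal_finsum [OF J] R.ideal_l [OF J])
qed (use R.ideal_zero [OF J] R.ideal_add [OF J] in \<open>auto simp: coeffs_in_iff\<close>)

text \<open>
  In the convolution sum for the coefficient of index \<open>m + n\<close>, every term other than
  \<open>p\<^sub>m q\<^sub>n\<close> involves an index below \<open>m\<close> in \<open>p\<close> or below \<open>n\<close> in \<open>q\<close>.
\<close>

lemma coeff_mult_mod:
  assumes J: "ideal J R" and p: "p \<in> carrier P" and q: "q \<in> carrier P"
    and pJ: "\<And>i. i < m \<Longrightarrow> coeff P p i \<otimes> coeff P q (m + n - i) \<in> J"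
    and qJ: "\<And>j. j < n \<Longrightarrow> coeff P p (m + n - j) \<otimes> coeff P q j \<in> J"
  shows "coeff P (p \<otimes>\<^bsub>P\<^esub> q) (m + n) \<ominus> coeff P p m \<otimes> coeff P q n \<in> J"
proof -
  let ?t = "\<lambda>i. coeff P p i \<otimes> coeff P q (m + n - i)"
  have cancel: "(x \<oplus> y) \<ominus> x = y" if "x \<in> carrier R" "y \<in> carrier R" for x y
    using that by (simp add: a_minus_def R.a_comm [of x y] R.a_assoc R.r_neg)
  have split: "{..m + n} = insert m ({..m + n} - {m})" by auto
  have "coeff P (p \<otimes>\<^bsub>P\<^esub> q) (m + n) = ?t m \<oplus> (\<Oplus>i\<in>{..m + n} - {m}. ?t i)"
    using p q by (subst coeff_mult, simp, simp, subst split, subst R.finsum_insert) auto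
  moreover have S: "(\<Oplus>i\<in>{..m + n} - {m}. ?t i) \<in> J"
  proof (rule R.ideal_finsum [OF J])
    fix i assume i: "i \<in> {..m + n} - {m}"
    show "?t i \<in> J"
    proof (cases "i < m")
      case False
      then have "m + n - i < n" "m + n - (m + n - i) = i" using i by auto
      then show ?thesis using qJ [of "m + n - i"] by simp
    qed (rule pJ)
  qed simp
  ultimately have "coeff P (p \<otimes>\<^bsub>P\<^esub> q) (m + n) \<ominus> ?t m = (\<Oplus>i\<in>{..m + n} - {m}. ?t i)"
    using cancel [OF _ R.ideal_carr [OF J S], of "?t m"] p q by simp
  then show ?thesis using S by simp
qed

lemma least_coeff_notin:
  assumes "p \<in> carrier P" "p \<notin> coeffs_in R J"
  obtains m where "coeff P p m \<notin> J" "\<And>i. i < m \<Longrightarrow> coeff P p i \<in> J"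
proof -
  obtain k where "coeff P p k \<notin> J" using assms by (auto simp: coeffs_in_iff)
  then show thesis
    using that [of "LEAST k. coeff P p k \<notin> J"] LeastI [of "\<lambda>k. coeff P p k \<notin> J"]
      not_less_Least by blast
qed

text \<open>
  If neither \<open>p\<close> nor \<open>q\<close> lies in \<open>M[X]\<close>, their least coefficients outside \<open>M\<close>, of index \<open>m\<close>
  and \<open>n\<close>, determine the coefficient of index \<open>m + n\<close> of \<open>p q\<close> modulo \<open>M\<close>.
\<close>

lemma primeideal_coeffs_in:
  assumes M: "primeideal M R"
  shows "primeideal (coeffs_in R M) P"
proof (rule primeidealI)
  have Mid: "ideal M R" using M by (rule primeideal.axioms)
  show "ideal (coeffs_in R M) P" by (rule ideal_coeffs_in [OF Mid])
  show "cring P" by (rule UP_cring)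
  have "\<one>\<^bsub>P\<^esub> \<notin> coeffs_in R M"
    using R.prime_one [OF M] by (auto simp: coeffs_in_iff intro!: exI [of _ 0])
  then show "carrier P \<noteq> coeffs_in R M" using UP_one_closed by blast
  fix p q assume p: "p \<in> carrier P" and q: "q \<in> carrier P"
    and pq: "p \<otimes>\<^bsub>P\<^esub> q \<in> coeffs_in R M"
  show "p \<in> coeffs_in R M \<or> q \<in> coeffs_in R M"
  proof (rule ccontr)
    assume "\<not> ?thesis"
    then obtain m n where m: "coeff P p m \<notin> M" "\<And>i. i < m \<Longrightarrow> coeff P p i \<in> M"
      and n: "coeff P q n \<notin> M" "\<And>i. i < n \<Longrightarrow> coeff P q i \<in> M"
      using least_coeff_notin p q by metis
    let ?z = "coeff P (p \<otimes>\<^bsub>P\<^esub> q) (m + n)" and ?xy = "coeff P p m \<otimes> coeff P q n"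
    have d: "?z \<ominus> ?xy \<in> M"
      by (rule coeff_mult_mod [OF Mid p q])
        (use m n p q R.ideal_l [OF Mid] R.ideal_r [OF Mid] in auto)
    have "?z \<in> M" using pq by (simp only: coeffs_in_iff)
    from R.ideal_mem_if_diff_mem [OF Mid this d] have "?xy \<in> M" using p q by simp
    then show False
      using R.prime_mult [OF M, of "coeff P p m" "coeff P q n"] m n p q by simp
  qed
qed

lemma coeffs_in_mult:
  assumes IJ: "ideal I R" "ideal J R" and p: "p \<in> coeffs_in R I" and q: "q \<in> coeffs_in R J"
  shows "p \<otimes>\<^bsub>P\<^esub> q \<in> coeffs_in R (I \<cdot> J)"
  using p q
  by (auto simp: coeffs_in_iff intro!: R.ideal_finsum [OF R.ideal_prod_is_ideal [OF IJ]]
      ideal_prod.prod)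

lemma monom_split: "a \<in> carrier R \<Longrightarrow> monom P a k = monom P \<one> k \<otimes>\<^bsub>P\<^esub> monom P a 0"
  using monom_mult [of \<one> a k 0] by simp

lemma coeff_const_mult:
  assumes "a \<in> carrier R" "p \<in> carrier P"
  shows "coeff P (monom P a 0 \<otimes>\<^bsub>P\<^esub> p) k = a \<otimes> coeff P p k"
  using assms by (simp add: monom_mult_is_smult del: coeff_mult)

lemma mem_ideal_if_coeffs:
  assumes E: "ideal E P" and p: "p \<in> carrier P" and c: "\<And>i. monom P (coeff P p i) 0 \<in> E"
  shows "p \<in> E"
proof -
  have "(\<Oplus>\<^bsub>P\<^esub>i\<in>{..deg R p}. monom P (coeff P p i) i) \<in> E"
  proof (rule P.ideal_finsum [OF E])
    fix i
    show "monom P (coeff P p i) i \<in> E"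
      using P.ideal_l [OF E c, of "monom P \<one> i" i] p monom_split [of "coeff P p i" i] by simp
  qed simp
  then show ?thesis using up_repr [OF p] by simp
qed

lemma ideal_contraction:
  assumes E: "ideal E P"
  shows "ideal {x \<in> carrier R. monom P x 0 \<in> E} R"
proof (rule R.idealI_comm)
  fix r x assume "r \<in> carrier R" "x \<in> {x \<in> carrier R. monom P x 0 \<in> E}"
  then show "r \<otimes> x \<in> {x \<in> carrier R. monom P x 0 \<in> E}"
    using P.ideal_l [OF E, of "monom P x 0" "monom P r 0"] monom_mult [of r x 0 0] by simp
qed (use P.ideal_zero [OF E] P.ideal_add [OF E] in auto)

lemma ideal_content:
  assumes "p \<in> carrier P"
  shows "ideal (content_ideal R p) R"
  unfolding content_ideal_def P_def [symmetric]
  using assms by (intro R.genideal_ideal) auto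

lemma coeff_in_content:
  assumes "p \<in> carrier P"
  shows "coeff P p i \<in> content_ideal R p"
proof (cases "i \<le> deg R p")
  case True
  have "coeff P p ` {..deg R p} \<subseteq> Idl (coeff P p ` {..deg R p})"
    using assms by (intro R.genideal_self) auto
  then show ?thesis
    using True unfolding content_ideal_def P_def [symmetric] by blast
next
  case False
  then show ?thesis
    using R.ideal_zero [OF ideal_content [OF assms]] assms by (simp add: deg_aboveD)
qed

lemma mem_coeffs_in_content: "p \<in> carrier P \<Longrightarrow> p \<in> coeffs_in R (content_ideal R p)"
  by (simp add: coeffs_in_iff coeff_in_content)

lemma content_subset_iff:
  assumes "p \<in> carrier P" "ideal J R"
  shows "content_ideal R p \<subseteq> J \<longleftrightarrow> p \<in> coeffs_in R J"
proof
  assume "content_ideal R p \<subseteq> J"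
  then show "p \<in> coeffs_in R J"
    using assms(1) coeff_in_content by (auto simp: coeffs_in_iff)
next
  assume "p \<in> coeffs_in R J"
  then show "content_ideal R p \<subseteq> J"
    unfolding content_ideal_def P_def [symmetric]
    by (intro R.genideal_minimal assms) (auto simp: coeffs_in_iff)
qed

lemma content_mult_subset:
  assumes "p \<in> carrier P" "q \<in> carrier P"
  shows "content_ideal R (p \<otimes>\<^bsub>P\<^esub> q) \<subseteq> content_ideal R p \<cdot> content_ideal R q"
  using assms coeffs_in_mult [OF ideal_content ideal_content mem_coeffs_in_content
      mem_coeffs_in_content]
  by (subst content_subset_iff) (auto intro: R.ideal_prod_is_ideal ideal_content)

lemma gaussian_iff:
  "gaussian_poly R f \<longleftrightarrow> f \<in> carrier P \<and>
    (\<forall>g \<in> carrier P. content_ideal R (f \<otimes>\<^bsub>P\<^esub> g) = content_ideal R f \<cdot> content_ideal R g)"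
  by (simp add: gaussian_poly_def P_def)

lemma content_gaussian_mult:
  "gaussian_poly R f \<Longrightarrow> g \<in> carrier P \<Longrightarrow>
    content_ideal R (f \<otimes>\<^bsub>P\<^esub> g) = content_ideal R f \<cdot> content_ideal R g"
  by (simp add: gaussian_iff)

lemma gaussian_carr: "gaussian_poly R f \<Longrightarrow> f \<in> carrier P"
  by (simp add: gaussian_iff)

lemma gaussian_mult:
  assumes f: "gaussian_poly R f" and g: "gaussian_poly R g"
  shows "gaussian_poly R (f \<otimes>\<^bsub>P\<^esub> g)"
  using gaussian_carr [OF f] gaussian_carr [OF g]
  by (simp add: gaussian_iff [of "f \<otimes>\<^bsub>P\<^esub> g"] P.m_assoc content_gaussian_mult [OF f]
      content_gaussian_mult [OF g] R.ideal_prod_assoc ideal_content)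

lemma content_one: "content_ideal R \<one>\<^bsub>P\<^esub> = carrier R"
  using coeff_in_content [OF UP_one_closed, of 0] ideal_content [OF UP_one_closed]
    ideal.one_imp_carrier by simp

lemma gaussian_one: "gaussian_poly R \<one>\<^bsub>P\<^esub>"
  by (simp add: gaussian_iff content_one R.ideal_prod_commute [OF R.oneideal]
      R.ideal_prod_one ideal_content)

lemma gaussian_pow: "gaussian_poly R f \<Longrightarrow> gaussian_poly R (f [^]\<^bsub>P\<^esub> (k::nat))"
  by (induction k) (simp_all add: gaussian_one gaussian_mult)

lemma content_pow_add:
  assumes "gaussian_poly R f"
  shows "content_ideal R (f [^]\<^bsub>P\<^esub> (j::nat)) \<cdot> content_ideal R (f [^]\<^bsub>P\<^esub> (k::nat)) =
    content_ideal R (f [^]\<^bsub>P\<^esub> (j + k))"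
  using gaussian_carr [OF assms] content_gaussian_mult [OF gaussian_pow [OF assms]]
  by (simp add: P.nat_pow_mult [symmetric])

end


section \<open>Powers of the content of a Gaussian polynomial have few generators\<close>

text \<open>
  The polynomial \<open>p(X\<^sup>2)\<close>.
\<close>

definition dilate :: "('a, 'm) ring_scheme \<Rightarrow> (nat \<Rightarrow> 'a) \<Rightarrow> nat \<Rightarrow> 'a"
  where "dilate R p = (\<lambda>i. if even i then coeff (UP R) p (i div 2) else \<zero>\<^bsub>R\<^esub>)"

context UP_cring
begin

lemma poly_of_coeffs:
  assumes "\<And>i. g i \<in> carrier R" "\<And>i. i > n \<Longrightarrow> g i = \<zero>"
  shows "g \<in> carrier P" "coeff P g i = g i"
proof -
  have "g \<in> up R" using assms by (intro mem_upI exI [of _ n] bound.intro) auto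
  then show "g \<in> carrier P" "coeff P g i = g i" by (simp_all add: P_def UP_def)
qed

lemma
  assumes "p \<in> carrier P"
  shows dilate_closed [simp]: "dilate R p \<in> carrier P"
    and coeff_dilate [simp]:
      "coeff P (dilate R p) i = (if even i then coeff P p (i div 2) else \<zero>)"
proof -
  let ?g = "\<lambda>i. if even i then coeff P p (i div 2) else \<zero>"
  have g: "?g i \<in> carrier R" "i > 2 * deg R p \<Longrightarrow> ?g i = \<zero>" for i
    using assms by (auto intro!: deg_aboveD)
  have "dilate R p = ?g" by (simp only: dilate_def P_def)
  then show "dilate R p \<in> carrier P" "coeff P (dilate R p) i = ?g i"
    using poly_of_coeffs [of ?g, OF g] by simp_all
qed

lemma dilate_mult:
  assumes p: "p \<in> carrier P" and q: "q \<in> carrier P"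
  shows "dilate R (p \<otimes>\<^bsub>P\<^esub> q) = dilate R p \<otimes>\<^bsub>P\<^esub> dilate R q"
proof (rule up_eqI)
  fix n
  let ?t = "\<lambda>i. coeff P (dilate R p) i \<otimes> coeff P (dilate R q) (n - i)"
  have c: "?t \<in> A \<rightarrow> carrier R" for A using p q by (auto simp del: coeff_dilate)
  have R: "coeff P (dilate R p \<otimes>\<^bsub>P\<^esub> dilate R q) n = (\<Oplus>i\<in>{..n}. ?t i)"
    using p q by (subst coeff_mult) auto
  show "coeff P (dilate R (p \<otimes>\<^bsub>P\<^esub> q)) n = coeff P (dilate R p \<otimes>\<^bsub>P\<^esub> dilate R q) n"
  proof (cases "even n")
    case True
    then obtain k where n: "n = 2 * k" by blast
    have "(\<Oplus>i\<in>{..n}. ?t i) = (\<Oplus>i\<in>(*) 2 ` {..k}. ?t i)"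
    proof (rule R.add.finprod_mono_neutral_cong_right)
      fix i assume i: "i \<in> {..n} - (*) 2 ` {..k}"
      have "odd i"
      proof
        assume "even i"
        then obtain j where "i = 2 * j" by blast
        then show False using i n by auto
      qed
      then show "?t i = \<zero>" using p q by simp
    qed (use c n in auto)
    also have "\<dots> = (\<Oplus>j\<in>{..k}. ?t (2 * j))"
      using c by (intro R.finsum_reindex) (auto simp: inj_on_def)
    also have "\<dots> = (\<Oplus>j\<in>{..k}. coeff P p j \<otimes> coeff P q (k - j))"
    proof (rule R.finsum_cong')
      fix j assume "j \<in> {..k}"
      have "n - 2 * j = 2 * (k - j)" using n by simp
      then show "?t (2 * j) = coeff P p j \<otimes> coeff P q (k - j)" using p q by simp
    qed (use p q in auto)
    finally show ?thesis unfolding R using p q n by simp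
  next
    case False
    have "(\<Oplus>i\<in>{..n}. ?t i) = (\<Oplus>i\<in>{..n}. \<zero>)"
      using p q False by (intro R.finsum_cong') auto
    then show ?thesis unfolding R using p q False by simp
  qed
qed (use p q in simp_all)

lemma coeff_X_mult:
  assumes "p \<in> carrier P"
  shows "coeff P (monom P \<one> 1 \<otimes>\<^bsub>P\<^esub> p) i = (if i = 0 then \<zero> else coeff P p (i - 1))"
proof (cases i)
  case (Suc j)
  then show ?thesis using coeff_monom_mult [of \<one> p 1 j] assms by simp
qed (use assms in simp)

lemma content_cong:
  assumes "p \<in> carrier P" "q \<in> carrier P"
    and "\<And>J. ideal J R \<Longrightarrow> p \<in> coeffs_in R J \<longleftrightarrow> q \<in> coeffs_in R J"
  shows "content_ideal R p = content_ideal R q"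
  using assms content_subset_iff ideal_content by blast

lemma content_dilate:
  assumes "p \<in> carrier P"
  shows "content_ideal R (dilate R p) = content_ideal R p"
proof (rule content_cong)
  fix J assume J: "ideal J R"
  show "dilate R p \<in> coeffs_in R J \<longleftrightarrow> p \<in> coeffs_in R J"
  proof
    assume D: "dilate R p \<in> coeffs_in R J"
    have "coeff P p i \<in> J" for i
    proof -
      have "coeff P (dilate R p) (2 * i) \<in> J" using D by (simp only: coeffs_in_iff)
      then show ?thesis using assms by simp
    qed
    then show "p \<in> coeffs_in R J" using assms by (simp add: coeffs_in_iff)
  qed (use assms R.ideal_zero [OF J] in \<open>auto simp: coeffs_in_iff\<close>)
qed (use assms in simp_all)

text \<open>
  \<open>a(X\<^sup>2) - X b(X\<^sup>2)\<close> arises from \<open>a(X\<^sup>2) + X b(X\<^sup>2)\<close> by \<open>X \<mapsto> -X\<close>, which changes coefficients only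
  by signs. Working with the even and odd parts avoids treating this substitution as a ring
  homomorphism.
\<close>

lemma content_interleave_minus:
  assumes a: "a \<in> carrier P" and b: "b \<in> carrier P"
  shows "content_ideal R (dilate R a \<ominus>\<^bsub>P\<^esub> monom P \<one> 1 \<otimes>\<^bsub>P\<^esub> dilate R b) =
    content_ideal R (dilate R a \<oplus>\<^bsub>P\<^esub> monom P \<one> 1 \<otimes>\<^bsub>P\<^esub> dilate R b)"
proof (rule content_cong)
  let ?B = "monom P \<one> 1 \<otimes>\<^bsub>P\<^esub> dilate R b"
  have B: "?B \<in> carrier P" using b by simp
  fix J assume J: "ideal J R"
  have neg: "\<ominus> x \<in> J \<longleftrightarrow> x \<in> J" if "x \<in> carrier R" for x
    using R.ideal_l [OF J, of x "\<ominus> \<one>"] R.ideal_l [OF J, of "\<ominus> x" "\<ominus> \<one>"] that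
    by (auto simp: R.l_minus)
  have "coeff P (dilate R a \<ominus>\<^bsub>P\<^esub> ?B) i \<in> J \<longleftrightarrow> coeff P (dilate R a \<oplus>\<^bsub>P\<^esub> ?B) i \<in> J" for i
    using a b B neg
    by (cases "even i")
      (auto simp: P.minus_eq coeff_X_mult simp del: One_nat_def coeff_mult elim!: oddE)
  then show "dilate R a \<ominus>\<^bsub>P\<^esub> ?B \<in> coeffs_in R J \<longleftrightarrow> dilate R a \<oplus>\<^bsub>P\<^esub> ?B \<in> coeffs_in R J"
    using a B by (simp add: coeffs_in_iff)
qed (use a b in simp_all)

lemma even_odd_parts:
  assumes f: "f \<in> carrier P"
  obtains a b where "a \<in> carrier P" "b \<in> carrier P"
    "f = dilate R a \<oplus>\<^bsub>P\<^esub> monom P \<one> 1 \<otimes>\<^bsub>P\<^esub> dilate R b"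
proof -
  let ?a = "\<lambda>i. coeff P f (2 * i)" and ?b = "\<lambda>i. coeff P f (2 * i + 1)"
  have z: "?a i = \<zero>" "?b i = \<zero>" if "i > deg R f" for i
    using that f by (auto intro!: deg_aboveD)
  have a: "?a \<in> carrier P" "coeff P ?a i = ?a i" for i
    using poly_of_coeffs [of ?a "deg R f"] z f by auto
  have b: "?b \<in> carrier P" "coeff P ?b i = ?b i" for i
    using poly_of_coeffs [of ?b "deg R f"] z f by auto
  have "f = dilate R ?a \<oplus>\<^bsub>P\<^esub> monom P \<one> 1 \<otimes>\<^bsub>P\<^esub> dilate R ?b"
  proof (rule up_eqI)
    fix i
    show "coeff P f i = coeff P (dilate R ?a \<oplus>\<^bsub>P\<^esub> monom P \<one> 1 \<otimes>\<^bsub>P\<^esub> dilate R ?b) i"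
      using f a b
      by (cases "even i")
        (auto simp: coeff_X_mult simp del: One_nat_def coeff_mult elim!: oddE evenE)
  qed (use f a b in simp_all)
  then show thesis using that a(1) b(1) by blast
qed

text \<open>
  Take \<open>F\<close> with \<open>F(X\<^sup>2) = f(X) f(-X)\<close>. If \<open>f = a(X\<^sup>2) + X b(X\<^sup>2)\<close> then \<open>F = a\<^sup>2 - X b\<^sup>2\<close>, and
  comparing degrees in \<open>F(X\<^sup>2)\<close> bounds the degree of \<open>F\<close> by that of \<open>f\<close>. For the content of \<open>F h\<close>,
  pass to \<open>f(X) f(-X) h(X\<^sup>2)\<close> and split off \<open>f(X)\<close>; the factor \<open>f(-X) h(X\<^sup>2)\<close> has the same content
  as \<open>f(X) h(X\<^sup>2)\<close>, because \<open>X \<mapsto> -X\<close> fixes \<open>h(X\<^sup>2)\<close>.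
\<close>

lemma gaussian_square:
  assumes f: "gaussian_poly R f"
  obtains F where "gaussian_poly R F" "deg R F \<le> deg R f"
    "content_ideal R F = content_ideal R f \<cdot> content_ideal R f"
proof -
  note fc = gaussian_carr [OF f]
  obtain a b where a: "a \<in> carrier P" and b: "b \<in> carrier P"
    and fab: "f = dilate R a \<oplus>\<^bsub>P\<^esub> monom P \<one> 1 \<otimes>\<^bsub>P\<^esub> dilate R b"
    by (rule even_odd_parts [OF fc])
  let ?X = "monom P \<one> 1"
  have X: "?X \<in> carrier P" by simp
  define f' where "f' = dilate R a \<ominus>\<^bsub>P\<^esub> ?X \<otimes>\<^bsub>P\<^esub> dilate R b"
  define F where "F = a \<otimes>\<^bsub>P\<^esub> a \<ominus>\<^bsub>P\<^esub> ?X \<otimes>\<^bsub>P\<^esub> (b \<otimes>\<^bsub>P\<^esub> b)"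
  have f'c: "f' \<in> carrier P" using a b by (simp add: f'_def)
  have Fc: "F \<in> carrier P" using a b by (simp add: F_def)
  have sq: "(u \<oplus>\<^bsub>P\<^esub> v) \<otimes>\<^bsub>P\<^esub> (u \<ominus>\<^bsub>P\<^esub> v) = u \<otimes>\<^bsub>P\<^esub> u \<ominus>\<^bsub>P\<^esub> v \<otimes>\<^bsub>P\<^esub> v"
    if "u \<in> carrier P" "v \<in> carrier P" for u v
    using that
    by (simp add: P.minus_eq P.l_distr P.r_distr P.r_minus P.m_comm [of v u] P.minus_add
        P.a_assoc P.r_neg2)
  have dX: "dilate R ?X = ?X \<otimes>\<^bsub>P\<^esub> ?X"
  proof (rule up_eqI)
    fix n show "coeff P (dilate R ?X) n = coeff P (?X \<otimes>\<^bsub>P\<^esub> ?X) n"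
      by (subst monom_mult [symmetric]) (auto elim!: evenE simp del: monom_mult, presburger)
  qed simp_all
  have dminus: "dilate R (u \<ominus>\<^bsub>P\<^esub> v) = dilate R u \<ominus>\<^bsub>P\<^esub> dilate R v"
    if "u \<in> carrier P" "v \<in> carrier P" for u v
    by (rule up_eqI) (use that in \<open>auto simp: P.minus_eq\<close>)
  have prod: "f \<otimes>\<^bsub>P\<^esub> f' = dilate R F"
  proof -
    have "f \<otimes>\<^bsub>P\<^esub> f' = dilate R a \<otimes>\<^bsub>P\<^esub> dilate R a \<ominus>\<^bsub>P\<^esub>
        (?X \<otimes>\<^bsub>P\<^esub> dilate R b) \<otimes>\<^bsub>P\<^esub> (?X \<otimes>\<^bsub>P\<^esub> dilate R b)"
      unfolding fab f'_def using a b by (intro sq) simp_all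
    also have "\<dots> = dilate R F"
      unfolding F_def using a b X by (simp add: dminus dilate_mult dX P.m_ac
        del: monom_mult One_nat_def)
    finally show ?thesis .
  qed
  have twist: "content_ideal R (f' \<otimes>\<^bsub>P\<^esub> dilate R h) = content_ideal R f \<cdot> content_ideal R h"
    if h: "h \<in> carrier P" for h
  proof -
    have "f' \<otimes>\<^bsub>P\<^esub> dilate R h =
        dilate R (a \<otimes>\<^bsub>P\<^esub> h) \<ominus>\<^bsub>P\<^esub> ?X \<otimes>\<^bsub>P\<^esub> dilate R (b \<otimes>\<^bsub>P\<^esub> h)"
      unfolding f'_def using a b h
      by (simp add: dilate_mult P.minus_eq P.l_distr P.l_minus P.m_assoc)
    moreover have "f \<otimes>\<^bsub>P\<^esub> dilate R h =
        dilate R (a \<otimes>\<^bsub>P\<^esub> h) \<oplus>\<^bsub>P\<^esub> ?X \<otimes>\<^bsub>P\<^esub> dilate R (b \<otimes>\<^bsub>P\<^esub> h)"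
      unfolding fab using a b h by (simp add: dilate_mult P.l_distr P.m_assoc)
    ultimately have "content_ideal R (f' \<otimes>\<^bsub>P\<^esub> dilate R h) =
        content_ideal R (f \<otimes>\<^bsub>P\<^esub> dilate R h)"
      using content_interleave_minus [of "a \<otimes>\<^bsub>P\<^esub> h" "b \<otimes>\<^bsub>P\<^esub> h"] a b h by simp
    then show ?thesis
      using h by (simp add: content_gaussian_mult [OF f] content_dilate)
  qed
  have F1: "content_ideal R (F \<otimes>\<^bsub>P\<^esub> h) =
      content_ideal R f \<cdot> (content_ideal R f \<cdot> content_ideal R h)" if h: "h \<in> carrier P" for h
  proof -
    have "content_ideal R (F \<otimes>\<^bsub>P\<^esub> h) = content_ideal R (f \<otimes>\<^bsub>P\<^esub> (f' \<otimes>\<^bsub>P\<^esub> dilate R h))"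
      using Fc f'c fc h
      by (simp add: content_dilate [symmetric, of "F \<otimes>\<^bsub>P\<^esub> h"] dilate_mult prod [symmetric]
          P.m_assoc)
    then show ?thesis using f'c h by (simp add: content_gaussian_mult [OF f] twist)
  qed
  have F2: "content_ideal R F = content_ideal R f \<cdot> content_ideal R f"
    using F1 [OF UP_one_closed] Fc by (simp add: content_one R.ideal_prod_one ideal_content fc)
  have "gaussian_poly R F"
    unfolding gaussian_iff using F1 F2 Fc by (simp add: R.ideal_prod_assoc ideal_content fc)
  moreover have "deg R F \<le> deg R f"
  proof (rule deg_aboveI [OF _ Fc])
    fix n assume n: "deg R f < n"
    have "deg R f' \<le> deg R f"
    proof (rule deg_aboveI [OF _ f'c])
      fix i assume i: "deg R f < i"
      have "coeff P f i = \<zero>" using i fc by (rule deg_aboveD)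
      then show "coeff P f' i = \<zero>"
        using a b unfolding fab f'_def
        by (cases "even i")
          (auto simp: P.minus_eq coeff_X_mult simp del: One_nat_def coeff_mult elim!: oddE)
    qed
    then have "deg R (f \<otimes>\<^bsub>P\<^esub> f') < 2 * n"
      using deg_mult_ring [OF fc f'c] n by linarith
    then have "coeff P (f \<otimes>\<^bsub>P\<^esub> f') (2 * n) = \<zero>"
      using fc f'c by (intro deg_aboveD) auto
    then show "coeff P F n = \<zero>" unfolding prod using Fc by simp
  qed
  ultimately show thesis using that F2 by blast
qed

text \<open>
  Iterating the squaring step doubles the exponent and keeps the degree bounded: arbitrarily
  high powers of the content are generated by at most \<open>deg f + 1\<close> elements. (The coefficients of
  \<open>f\<^sup>m\<close> itself would give a number of generators growing with \<open>m\<close>.)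
\<close>

lemma gaussian_power_few_generators:
  assumes f: "gaussian_poly R f"
  obtains F m where "gaussian_poly R F" "deg R F \<le> deg R f" "N \<le> (m::nat)"
    "content_ideal R F = content_ideal R (f [^]\<^bsub>P\<^esub> m)"
proof -
  have "\<exists>F. gaussian_poly R F \<and> deg R F \<le> deg R f \<and>
      content_ideal R F = content_ideal R (f [^]\<^bsub>P\<^esub> ((2::nat) ^ k))" for k
  proof (induction k)
    case 0
    then show ?case using f gaussian_carr [OF f] by (intro exI [of _ f]) simp
  next
    case (Suc k)
    then obtain F where F: "gaussian_poly R F" "deg R F \<le> deg R f"
      "content_ideal R F = content_ideal R (f [^]\<^bsub>P\<^esub> ((2::nat) ^ k))" by blast
    obtain G where "gaussian_poly R G" "deg R G \<le> deg R F"
      "content_ideal R G = content_ideal R F \<cdot> content_ideal R F"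
      by (rule gaussian_square [OF F(1)])
    then show ?case using F content_pow_add [OF f, of "2 ^ k" "2 ^ k"] 
      by (intro exI [of _ G]) (simp add: mult_2)
  qed
  from this [of N] show thesis using that [of _ "2 ^ N"] less_exp [of N] by (metis less_imp_le)
qed

end


section \<open>A power of the content is locally divisible by the polynomial\<close>

context cring
begin

lemma ideal_combinations:
  assumes A: "finite A" and w: "\<And>l. l \<in> A \<Longrightarrow> w l \<in> carrier R"
  shows "ideal {(\<Oplus>l\<in>A. b l \<otimes> w l) | b. \<forall>l. b l \<in> carrier R} R" (is "ideal ?E R")
    and "k \<in> A \<Longrightarrow> w k \<in> {(\<Oplus>l\<in>A. b l \<otimes> w l) | b. \<forall>l. b l \<in> carrier R}"
proof -
  have mem: "(\<Oplus>l\<in>A. b l \<otimes> w l) \<in> ?E" if "\<forall>l. b l \<in> carrier R" for b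
    using that by blast
  show "ideal ?E R"
  proof (rule idealI_comm)
    show "?E \<subseteq> carrier R" using w by auto
    have "(\<Oplus>l\<in>A. \<zero> \<otimes> w l) = (\<Oplus>l\<in>A. \<zero>)" using w by (intro finsum_cong') auto
    then show "\<zero> \<in> ?E" using mem [of "\<lambda>l. \<zero>"] by simp
  next
    fix x y assume "x \<in> ?E" "y \<in> ?E"
    then obtain b b' where b: "\<forall>l. b l \<in> carrier R" "x = (\<Oplus>l\<in>A. b l \<otimes> w l)"
      "\<forall>l. b' l \<in> carrier R" "y = (\<Oplus>l\<in>A. b' l \<otimes> w l)" by blast
    have "x \<oplus> y = (\<Oplus>l\<in>A. b l \<otimes> w l \<oplus> b' l \<otimes> w l)"
      unfolding b using b w by (subst finsum_addf) auto
    also have "\<dots> = (\<Oplus>l\<in>A. (b l \<oplus> b' l) \<otimes> w l)"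
      using b w by (intro finsum_cong') (auto simp: l_distr)
    finally show "x \<oplus> y \<in> ?E" using mem [of "\<lambda>l. b l \<oplus> b' l"] b by simp
  next
    fix r x assume r: "r \<in> carrier R" and "x \<in> ?E"
    then obtain b where b: "\<forall>l. b l \<in> carrier R" "x = (\<Oplus>l\<in>A. b l \<otimes> w l)" by blast
    have "r \<otimes> x = (\<Oplus>l\<in>A. r \<otimes> (b l \<otimes> w l))"
      unfolding b using b w r A by (subst finsum_rdistr) auto
    also have "\<dots> = (\<Oplus>l\<in>A. (r \<otimes> b l) \<otimes> w l)"
      using b w r by (intro finsum_cong') (auto simp: m_assoc)
    finally show "r \<otimes> x \<in> ?E" using mem [of "\<lambda>l. r \<otimes> b l"] b r by simp
  qed
  assume k: "k \<in> A"
  have "(\<Oplus>l\<in>A. (if l = k then \<one> else \<zero>) \<otimes> w l) = (\<Oplus>l\<in>A. if k = l then w l else \<zero>)"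
    using w by (intro finsum_cong') auto
  also have "\<dots> = w k" using A k w by (intro add.finprod_singleton) auto
  finally show "w k \<in> ?E" using mem [of "\<lambda>l. if l = k then \<one> else \<zero>"] by simp
qed

lemma finsum_swap_mult:
  assumes "finite A" "finite L" "\<And>i. i \<in> A \<Longrightarrow> u i \<in> carrier R"
    and "\<And>i l. i \<in> A \<Longrightarrow> B i l \<in> carrier R" "\<And>l. l \<in> L \<Longrightarrow> w l \<in> carrier R"
  shows "(\<Oplus>i\<in>A. u i \<otimes> (\<Oplus>l\<in>L. B i l \<otimes> w l)) = (\<Oplus>l\<in>L. (\<Oplus>i\<in>A. u i \<otimes> B i l) \<otimes> w l)"
  using assms(1,3,4)
proof (induction A rule: finite_induct)
  case empty
  have "(\<Oplus>l\<in>L. \<zero> \<otimes> w l) = (\<Oplus>l\<in>L. \<zero>)" using assms(5) by (intro finsum_cong') auto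
  then show ?case by simp
next
  case (insert a A)
  have c: "(\<Oplus>i\<in>A. u i \<otimes> B i l) \<in> carrier R" for l
    using insert.prems by (intro finsum_closed) auto
  have "(\<Oplus>i\<in>insert a A. u i \<otimes> (\<Oplus>l\<in>L. B i l \<otimes> w l)) =
      u a \<otimes> (\<Oplus>l\<in>L. B a l \<otimes> w l) \<oplus> (\<Oplus>i\<in>A. u i \<otimes> (\<Oplus>l\<in>L. B i l \<otimes> w l))"
    using insert assms(5) by (subst finsum_insert) auto
  also have "u a \<otimes> (\<Oplus>l\<in>L. B a l \<otimes> w l) = (\<Oplus>l\<in>L. u a \<otimes> (B a l \<otimes> w l))"
    using insert.prems assms by (subst finsum_rdistr) auto
  also have "(\<Oplus>i\<in>A. u i \<otimes> (\<Oplus>l\<in>L. B i l \<otimes> w l)) = (\<Oplus>l\<in>L. (\<Oplus>i\<in>A. u i \<otimes> B i l) \<otimes> w l)"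
    using insert by auto
  also have "(\<Oplus>l\<in>L. u a \<otimes> (B a l \<otimes> w l)) \<oplus> (\<Oplus>l\<in>L. (\<Oplus>i\<in>A. u i \<otimes> B i l) \<otimes> w l) =
      (\<Oplus>l\<in>L. u a \<otimes> (B a l \<otimes> w l) \<oplus> (\<Oplus>i\<in>A. u i \<otimes> B i l) \<otimes> w l)"
    using insert.prems assms(5) c by (subst finsum_addf) auto
  also have "\<dots> = (\<Oplus>l\<in>L. (\<Oplus>i\<in>insert a A. u i \<otimes> B i l) \<otimes> w l)"
    using insert assms(5) c by (intro finsum_cong') (auto simp: l_distr m_assoc)
  finally show ?case .
qed

end

context UP_cring
begin

lemma coeffs_in_combination:
  assumes S: "finite A" "\<And>l. l \<in> A \<Longrightarrow> c l \<in> carrier R" and y: "y \<in> coeffs_in R (Idl (c ` A))"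
  obtains b where "\<forall>l. b l \<in> carrier P" "y = (\<Oplus>\<^bsub>P\<^esub>l\<in>A. b l \<otimes>\<^bsub>P\<^esub> monom P (c l) 0)"
proof -
  let ?E = "{(\<Oplus>\<^bsub>P\<^esub>l\<in>A. b l \<otimes>\<^bsub>P\<^esub> monom P (c l) 0) | b. \<forall>l. b l \<in> carrier P}"
  have E: "ideal ?E P"
    by (rule P.ideal_combinations) (use S in auto)
  have "c ` A \<subseteq> {x \<in> carrier R. monom P x 0 \<in> ?E}"
  proof
    fix x assume "x \<in> c ` A"
    then obtain l where "l \<in> A" "x = c l" by blast
    then show "x \<in> {x \<in> carrier R. monom P x 0 \<in> ?E}"
      using P.ideal_combinations(2) [of A "\<lambda>l. monom P (c l) 0" l] S by simp
  qed
  note sub = R.genideal_minimal [OF ideal_contraction [OF E] this]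
  have "y \<in> ?E"
  proof (rule mem_ideal_if_coeffs [OF E])
    show "y \<in> carrier P" using y by (simp only: coeffs_in_iff)
    fix i
    have "coeff P y i \<in> Idl (c ` A)" using y by (simp only: coeffs_in_iff)
    with sub have "coeff P y i \<in> {x \<in> carrier R. monom P x 0 \<in> ?E}" by (rule subsetD)
    then show "monom P (coeff P y i) 0 \<in> ?E" by simp
  qed
  then show thesis using that by blast
qed

lemma coeffs_in_prod_content_subset:
  assumes N: "ideal N P" and M: "M \<subseteq> carrier R" and F: "F \<in> carrier P"
    and gen: "\<And>p l. p \<in> coeffs_in R M \<Longrightarrow> l \<le> deg R F \<Longrightarrow>
      p \<otimes>\<^bsub>P\<^esub> monom P (coeff P F l) 0 \<in> N" and zM: "\<zero> \<in> M"
  shows "coeffs_in R (M \<cdot> content_ideal R F) \<subseteq> N"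
proof -
  let ?K = "{x \<in> carrier R. monom P x 0 \<in> N}"
  have K: "ideal ?K R" by (rule ideal_contraction [OF N])
  have "M \<cdot> content_ideal R F \<subseteq> ?K"
  proof (rule R.ideal_prod_subset [OF K])
    fix i j assume i: "i \<in> M" and j: "j \<in> content_ideal R F"
    have ic: "i \<in> carrier R" using i M by blast
    have D: "ideal {x \<in> carrier R. i \<otimes> x \<in> ?K} R" by (rule R.ideal_preimage_mult [OF K ic])
    have "coeff P F ` {..deg R F} \<subseteq> {x \<in> carrier R. i \<otimes> x \<in> ?K}"
    proof
      fix x assume "x \<in> coeff P F ` {..deg R F}"
      then obtain l where l: "l \<le> deg R F" "x = coeff P F l" by blast
      have "monom P i 0 \<in> coeffs_in R M" using i ic zM by (simp add: coeffs_in_iff)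
      from gen [OF this l(1)] show "x \<in> {x \<in> carrier R. i \<otimes> x \<in> ?K}"
        using ic l(2) F monom_mult [of i "coeff P F l" 0 0] by simp
    qed
    from R.genideal_minimal [OF D this] j show "i \<otimes> j \<in> ?K"
      unfolding content_ideal_def P_def [symmetric] by blast
  qed
  note sub = subsetD [OF this]
  show ?thesis
  proof
    fix p assume "p \<in> coeffs_in R (M \<cdot> content_ideal R F)"
    then have p: "p \<in> carrier P" "coeff P p i \<in> M \<cdot> content_ideal R F" for i
      by (simp_all only: coeffs_in_iff)
    show "p \<in> N"
      using sub [OF p(2)] by (intro mem_ideal_if_coeffs [OF N p(1)]) simp
  qed
qed

text \<open>
  The heart of the proof; \<open>N\<close> stands for \<open>f R[X] + M I\<^sub>m R[X]\<close>. Write \<open>I\<^sub>k\<close> for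
  the content of \<open>f\<^sup>k\<close>, so that \<open>I\<^sub>j I\<^sub>k = I\<^bsub>j+k\<^esub>\<close>, and let
  \<open>q = deg f + 1 \<le> m\<close>. Suppose that \<open>I\<^sub>m\<close> is not inside the saturation. Since
  \<open>I\<^sub>m = I\<^sub>i I\<^bsub>m-i\<^esub>\<close> for every \<open>i \<le> q\<close>, there are \<open>w\<^sub>i \<in> I\<^sub>i\<close> and \<open>b\<^sub>i \<in> I\<^bsub>m-i\<^esub>\<close> with
  \<open>w\<^sub>i b\<^sub>i\<close> outside it. The \<open>q + 1\<close> polynomials \<open>f\<^bsup>m-i\<^esup> w\<^sub>i\<close> have coefficients in \<open>I\<^sub>m\<close>, which has
  at most \<open>q\<close> generators, so some combination \<open>\<Sum> u\<^sub>i f\<^bsup>m-i\<^esup> w\<^sub>i\<close> with not all \<open>u\<^sub>i\<close> in \<open>M[X]\<close> has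
  coefficients in \<open>M I\<^sub>m\<close>. If \<open>s\<close> is the last index with \<open>u\<^sub>s \<notin> M[X]\<close>, then up to such terms the
  combination is \<open>f\<^bsup>m-s\<^esup> h\<close> with \<open>h = \<Sum>\<^bsub>i\<le>s\<^esub> u\<^sub>i f\<^bsup>s-i\<^esup> w\<^sub>i\<close>. The Gaussian property cancels the power
  of \<open>f\<close> against an element of its content: \<open>b\<^sub>s h\<close> has coefficients in \<open>M I\<^sub>m\<close>. As \<open>h\<close> is
  congruent to \<open>u\<^sub>s w\<^sub>s\<close> modulo \<open>f\<close>, this puts \<open>w\<^sub>s b\<^sub>s\<close> into the saturation.
\<close>

lemma gaussian_power_in_saturation:
  assumes f: "gaussian_poly R f" and M: "primeideal M R"
    and F: "F \<in> carrier P" "deg R F \<le> deg R f" "Suc (deg R f) \<le> m"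
      "content_ideal R F = content_ideal R (f [^]\<^bsub>P\<^esub> m)"
    and N: "ideal N P" "f \<in> N"
      "\<And>p l. p \<in> coeffs_in R M \<Longrightarrow> l \<le> deg R F \<Longrightarrow> p \<otimes>\<^bsub>P\<^esub> monom P (coeff P F l) 0 \<in> N"
    and x: "x \<in> content_ideal R F"
  shows "monom P x 0 \<in> saturation P (coeffs_in R M) N"
proof -
  define \<pp> where "\<pp> = coeffs_in R M"
  define I where "I k = content_ideal R (f [^]\<^bsub>P\<^esub> k)" for k :: nat
  define q where "q = Suc (deg R f)"
  define J where "J = M \<cdot> I m"
  note fc = gaussian_carr [OF f]
  have fk: "f [^]\<^bsub>P\<^esub> k \<in> carrier P" for k :: nat using fc by simp
  have Mid: "ideal M R" using M by (rule primeideal.axioms)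
  have P: "primeideal \<pp> P" unfolding \<pp>_def by (rule primeideal_coeffs_in [OF M])
  have Pid: "ideal \<pp> P" using P by (rule primeideal.axioms)
  have Iid: "ideal (I k) R" for k unfolding I_def by (rule ideal_content [OF fk])
  have Jid: "ideal J R" unfolding J_def by (rule R.ideal_prod_is_ideal [OF Mid Iid])
  have JP: "ideal (coeffs_in R J) P" by (rule ideal_coeffs_in [OF Jid])
  have Iadd: "I j \<cdot> I k = I (j + k)" for j k
    unfolding I_def by (rule content_pow_add [OF f])
  have JN: "coeffs_in R J \<subseteq> N"
    unfolding J_def I_def F(4) [symmetric]
    by (rule coeffs_in_prod_content_subset [OF N(1) _ F(1) N(3)])
      (use R.ideal_carr [OF Mid] R.ideal_zero [OF Mid] in auto)
  define G where "G = {x \<in> carrier R. monom P x 0 \<in> saturation P \<pp> N}"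
  have G: "ideal G R"
    unfolding G_def by (rule ideal_contraction [OF P.ideal_saturation [OF P N(1)]])
  have "I m \<subseteq> G"
  proof (rule ccontr)
    assume notG: "\<not> I m \<subseteq> G"
    have "\<exists>w b. w \<in> I i \<and> b \<in> I (m - i) \<and> w \<otimes> b \<notin> G" if "i \<le> q" for i
    proof (rule ccontr)
      assume "\<nexists>w b. w \<in> I i \<and> b \<in> I (m - i) \<and> w \<otimes> b \<notin> G"
      then have "I i \<cdot> I (m - i) \<subseteq> G" by (intro R.ideal_prod_subset [OF G]) blast
      then show False using notG Iadd [of i "m - i"] that F(3) by (simp add: q_def)
    qed
    then obtain w b where wb: "\<And>i. i \<le> q \<Longrightarrow> w i \<in> I i" "\<And>i. i \<le> q \<Longrightarrow> b i \<in> I (m - i)"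
      "\<And>i. i \<le> q \<Longrightarrow> w i \<otimes> b i \<notin> G" by metis
    have wc: "i \<le> q \<Longrightarrow> w i \<in> carrier R" and bc: "i \<le> q \<Longrightarrow> b i \<in> carrier R" for i
      using wb R.ideal_carr [OF Iid] by blast+
    define y where "y i = f [^]\<^bsub>P\<^esub> (m - i) \<otimes>\<^bsub>P\<^esub> monom P (w i) 0" for i
    have yc: "y i \<in> carrier P" if "i \<le> q" for i
      using fk wc [OF that] by (simp add: y_def)
    have yI: "y i \<in> coeffs_in R (I m)" if i: "i \<le> q" for i
    proof -
      have "monom P (w i) 0 \<in> coeffs_in R (I i)"
        using wb(1) [OF i] wc [OF i] R.ideal_zero [OF Iid] by (simp add: coeffs_in_iff)
      from coeffs_in_mult [OF Iid Iid mem_coeffs_in_content [OF fk, folded I_def] this]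
      have "y i \<in> coeffs_in R (I (m - i) \<cdot> I i)" unfolding y_def .
      then show ?thesis using Iadd [of "m - i" i] i F(3) by (simp add: q_def)
    qed
    let ?c = "\<lambda>l. monom P (coeff P F l) 0"
    have cc: "?c l \<in> carrier P" for l using F(1) by simp
    have ImF: "I m = content_ideal R F" by (simp add: I_def F(4))
    have Im: "I m = Idl (coeff P F ` {..<Suc (deg R F)})"
      unfolding ImF content_ideal_def P_def [symmetric] lessThan_Suc_atMost ..
    have "\<forall>i \<in> {..q}. \<exists>B. (\<forall>l. B l \<in> carrier P) \<and>
        y i = (\<Oplus>\<^bsub>P\<^esub>l\<in>{..<Suc (deg R F)}. B l \<otimes>\<^bsub>P\<^esub> ?c l)"
    proof
      fix i assume "i \<in> {..q}"
      then have "y i \<in> coeffs_in R (Idl (coeff P F ` {..<Suc (deg R F)}))"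
        using yI [of i] by (simp only: Im atMost_iff)
      from coeffs_in_combination [OF finite_lessThan coeff_closed [OF F(1)] this]
      show "\<exists>B. (\<forall>l. B l \<in> carrier P) \<and>
          y i = (\<Oplus>\<^bsub>P\<^esub>l\<in>{..<Suc (deg R F)}. B l \<otimes>\<^bsub>P\<^esub> ?c l)" by blast
    qed
    from bchoice [OF this] obtain B where B': "\<forall>i \<in> {..q}. (\<forall>l. B i l \<in> carrier P) \<and>
        y i = (\<Oplus>\<^bsub>P\<^esub>l\<in>{..<Suc (deg R F)}. B i l \<otimes>\<^bsub>P\<^esub> ?c l)" ..
    have B: "B i l \<in> carrier P"
      "y i = (\<Oplus>\<^bsub>P\<^esub>l\<in>{..<Suc (deg R F)}. B i l \<otimes>\<^bsub>P\<^esub> ?c l)" if "i \<le> q" for i l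
      using B' [rule_format, of i] that by (simp_all only: atMost_iff)
    have "\<exists>u. (\<forall>i \<in> {..q}. u i \<in> carrier P) \<and> (\<exists>i \<in> {..q}. u i \<notin> \<pp>) \<and>
        (\<forall>l < Suc (deg R F). (\<Oplus>\<^bsub>P\<^esub>i\<in>{..q}. u i \<otimes>\<^bsub>P\<^esub> B i l) \<in> \<pp>)"
      by (rule P.dependent_rows_mod_prime [OF P]) (use B(1) F(2) in \<open>auto simp: q_def\<close>)
    then obtain u where u: "\<forall>i \<in> {..q}. u i \<in> carrier P" "\<exists>i \<in> {..q}. u i \<notin> \<pp>"
      "\<forall>l < Suc (deg R F). (\<Oplus>\<^bsub>P\<^esub>i\<in>{..q}. u i \<otimes>\<^bsub>P\<^esub> B i l) \<in> \<pp>"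
      by (elim exE conjE)
    have uc: "i \<le> q \<Longrightarrow> u i \<in> carrier P" for i using u(1) by simp
    have pJ: "p \<otimes>\<^bsub>P\<^esub> z \<in> coeffs_in R J" if "p \<in> \<pp>" "z \<in> coeffs_in R (I m)" for p z
      unfolding J_def using that coeffs_in_mult [OF Mid Iid] by (simp add: \<pp>_def)
    have cI: "?c l \<in> coeffs_in R (I m)" for l
      using F(1) R.ideal_zero [OF Iid [of m]] coeff_in_content [OF F(1)]
      by (simp add: coeffs_in_iff ImF)
    have uy: "(\<Oplus>\<^bsub>P\<^esub>i\<in>{..q}. u i \<otimes>\<^bsub>P\<^esub> y i) \<in> coeffs_in R J"
    proof -
      have "(\<Oplus>\<^bsub>P\<^esub>i\<in>{..q}. u i \<otimes>\<^bsub>P\<^esub> y i) =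
          (\<Oplus>\<^bsub>P\<^esub>i\<in>{..q}. u i \<otimes>\<^bsub>P\<^esub> (\<Oplus>\<^bsub>P\<^esub>l\<in>{..<Suc (deg R F)}. B i l \<otimes>\<^bsub>P\<^esub> ?c l))"
        using uc B cc by (intro P.finsum_cong') auto
      also have "\<dots> = (\<Oplus>\<^bsub>P\<^esub>l\<in>{..<Suc (deg R F)}. (\<Oplus>\<^bsub>P\<^esub>i\<in>{..q}. u i \<otimes>\<^bsub>P\<^esub> B i l) \<otimes>\<^bsub>P\<^esub> ?c l)"
        by (rule P.finsum_swap_mult) (use uc B(1) cc in auto)
      also have "\<dots> \<in> coeffs_in R J"
        using u(3) cI by (intro P.ideal_finsum [OF JP] pJ) auto
      finally show ?thesis .
    qed
    \<comment> \<open>The terms beyond the last coefficient outside \<open>M[X]\<close> are themselves in \<open>M I\<^sub>m\<close>, and the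
      terms up to it share the factor \<open>f\<^bsup>m-s\<^esup>\<close>.\<close>
    define s where "s = Max {i. i \<le> q \<and> u i \<notin> \<pp>}"
    have U: "finite {i. i \<le> q \<and> u i \<notin> \<pp>}" "{i. i \<le> q \<and> u i \<notin> \<pp>} \<noteq> {}" using u(2) by auto
    have s: "s \<le> q" "u s \<notin> \<pp>" using Max_in [OF U] by (simp_all add: s_def)
    have smax: "u i \<in> \<pp>" if "s < i" "i \<le> q" for i
      using Max_ge [OF U(1), of i] that unfolding s_def by fastforce
    define h where "h = (\<Oplus>\<^bsub>P\<^esub>i\<in>{..s}. u i \<otimes>\<^bsub>P\<^esub> (f [^]\<^bsub>P\<^esub> (s - i) \<otimes>\<^bsub>P\<^esub> monom P (w i) 0))"
    have tc: "u i \<otimes>\<^bsub>P\<^esub> (f [^]\<^bsub>P\<^esub> (s - i) \<otimes>\<^bsub>P\<^esub> monom P (w i) 0) \<in> carrier P" if "i \<le> s" for i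
      using that s(1) uc wc fc by simp
    have hc: "h \<in> carrier P" unfolding h_def using tc by (intro P.finsum_closed) auto
    have "f [^]\<^bsub>P\<^esub> (m - s) \<otimes>\<^bsub>P\<^esub> h \<in> coeffs_in R J"
    proof -
      have "f [^]\<^bsub>P\<^esub> (m - s) \<otimes>\<^bsub>P\<^esub> h =
          (\<Oplus>\<^bsub>P\<^esub>i\<in>{..s}. f [^]\<^bsub>P\<^esub> (m - s) \<otimes>\<^bsub>P\<^esub>
            (u i \<otimes>\<^bsub>P\<^esub> (f [^]\<^bsub>P\<^esub> (s - i) \<otimes>\<^bsub>P\<^esub> monom P (w i) 0)))"
        unfolding h_def using tc fk by (intro P.finsum_rdistr) auto
      also have "\<dots> = (\<Oplus>\<^bsub>P\<^esub>i\<in>{..s}. u i \<otimes>\<^bsub>P\<^esub> y i)"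
      proof (rule P.finsum_cong')
        fix i assume "i \<in> {..s}"
        then have i: "i \<le> s" by simp
        have e: "m - i = (m - s) + (s - i)" using i s(1) F(3) by (simp add: q_def)
        show "f [^]\<^bsub>P\<^esub> (m - s) \<otimes>\<^bsub>P\<^esub> (u i \<otimes>\<^bsub>P\<^esub> (f [^]\<^bsub>P\<^esub> (s - i) \<otimes>\<^bsub>P\<^esub> monom P (w i) 0)) =
            u i \<otimes>\<^bsub>P\<^esub> y i"
          unfolding y_def e P.nat_pow_mult [OF fc, symmetric]
          using i s(1) uc [of i] wc [of i] fk by (simp add: P.m_ac)
      qed (use uc yc s(1) in auto)
      finally have 1: "f [^]\<^bsub>P\<^esub> (m - s) \<otimes>\<^bsub>P\<^esub> h = (\<Oplus>\<^bsub>P\<^esub>i\<in>{..s}. u i \<otimes>\<^bsub>P\<^esub> y i)" .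
      have tail: "(\<Oplus>\<^bsub>P\<^esub>i\<in>{s<..q}. u i \<otimes>\<^bsub>P\<^esub> y i) \<in> coeffs_in R J"
        using smax yI by (intro P.ideal_finsum [OF JP] pJ) auto
      have "(\<Oplus>\<^bsub>P\<^esub>i\<in>{..q}. u i \<otimes>\<^bsub>P\<^esub> y i) =
          (\<Oplus>\<^bsub>P\<^esub>i\<in>{..s} \<union> {s<..q}. u i \<otimes>\<^bsub>P\<^esub> y i)"
        using s(1) by (simp add: ivl_disj_un_one(3))
      also have "\<dots> = (\<Oplus>\<^bsub>P\<^esub>i\<in>{..s}. u i \<otimes>\<^bsub>P\<^esub> y i) \<oplus>\<^bsub>P\<^esub>
          (\<Oplus>\<^bsub>P\<^esub>i\<in>{s<..q}. u i \<otimes>\<^bsub>P\<^esub> y i)"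
        using uc yc s(1) by (intro P.finsum_Un_disjoint) auto
      finally have 2: "(\<Oplus>\<^bsub>P\<^esub>i\<in>{..q}. u i \<otimes>\<^bsub>P\<^esub> y i) =
          (\<Oplus>\<^bsub>P\<^esub>i\<in>{..s}. u i \<otimes>\<^bsub>P\<^esub> y i) \<oplus>\<^bsub>P\<^esub> (\<Oplus>\<^bsub>P\<^esub>i\<in>{s<..q}. u i \<otimes>\<^bsub>P\<^esub> y i)" .
      have "(\<Oplus>\<^bsub>P\<^esub>i\<in>{..s}. u i \<otimes>\<^bsub>P\<^esub> y i) \<in> carrier P"
        using uc yc s(1) by (intro P.finsum_closed) auto
      from P.add_minus_cancel [OF this P.ideal_carr [OF JP tail]]
      have "(\<Oplus>\<^bsub>P\<^esub>i\<in>{..s}. u i \<otimes>\<^bsub>P\<^esub> y i) =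
          (\<Oplus>\<^bsub>P\<^esub>i\<in>{..q}. u i \<otimes>\<^bsub>P\<^esub> y i) \<ominus>\<^bsub>P\<^esub> (\<Oplus>\<^bsub>P\<^esub>i\<in>{s<..q}. u i \<otimes>\<^bsub>P\<^esub> y i)"
        unfolding 2 by (rule sym)
      then show ?thesis unfolding 1 using P.ideal_minus [OF JP uy tail] by simp
    qed
    then have "content_ideal R (f [^]\<^bsub>P\<^esub> (m - s) \<otimes>\<^bsub>P\<^esub> h) \<subseteq> J"
      using content_subset_iff [OF _ Jid] hc fk by simp
    \<comment> \<open>The Gaussian property of \<open>f\<^bsup>m-s\<^esup>\<close> enters here.\<close>
    then have sub: "I (m - s) \<cdot> content_ideal R h \<subseteq> J"
      using content_gaussian_mult [OF gaussian_pow [OF f] hc] by (simp add: I_def)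
    have bh: "monom P (b s) 0 \<otimes>\<^bsub>P\<^esub> h \<in> N"
    proof -
      have "b s \<otimes> coeff P h k \<in> J" for k
        using sub ideal_prod.prod [OF wb(2) [OF s(1)] coeff_in_content [OF hc, of k]] by blast
      then have "monom P (b s) 0 \<otimes>\<^bsub>P\<^esub> h \<in> coeffs_in R J"
        using hc bc [OF s(1)] by (simp add: coeffs_in_iff coeff_const_mult del: coeff_mult)
      then show ?thesis using JN by blast
    qed
    have us: "u s \<otimes>\<^bsub>P\<^esub> monom P (w s \<otimes> b s) 0 \<in> N"
    proof -
      \<comment> \<open>All summands of \<open>h\<close> below index \<open>s\<close> contain a positive power of \<open>f\<close>.\<close>
      have low: "(\<Oplus>\<^bsub>P\<^esub>i\<in>{..<s}. u i \<otimes>\<^bsub>P\<^esub> (f [^]\<^bsub>P\<^esub> (s - i) \<otimes>\<^bsub>P\<^esub> monom P (w i) 0)) \<in> N"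
      proof (rule P.ideal_finsum [OF N(1)])
        fix i assume "i \<in> {..<s}"
        then have i: "i \<le> q" "s - i = Suc (s - i - 1)" using s(1) by auto
        have "f [^]\<^bsub>P\<^esub> (s - i) \<in> N"
          by (subst i(2), simp only: P.nat_pow_Suc) (rule P.ideal_l [OF N(1,2) fk])
        then show "u i \<otimes>\<^bsub>P\<^esub> (f [^]\<^bsub>P\<^esub> (s - i) \<otimes>\<^bsub>P\<^esub> monom P (w i) 0) \<in> N"
          using uc [OF i(1)] wc [OF i(1)]
          by (intro P.ideal_l [OF N(1)] P.ideal_r [OF N(1)]) auto
      qed simp
      let ?low = "(\<Oplus>\<^bsub>P\<^esub>i\<in>{..<s}. u i \<otimes>\<^bsub>P\<^esub> (f [^]\<^bsub>P\<^esub> (s - i) \<otimes>\<^bsub>P\<^esub> monom P (w i) 0))"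
      have lc: "?low \<in> carrier P" by (rule P.ideal_carr [OF N(1) low])
      have "{..s} = insert s {..<s}" by auto
      then have "h = u s \<otimes>\<^bsub>P\<^esub> (f [^]\<^bsub>P\<^esub> (s - s) \<otimes>\<^bsub>P\<^esub> monom P (w s) 0) \<oplus>\<^bsub>P\<^esub> ?low"
        unfolding h_def using tc uc [OF s(1)] wc [OF s(1)]
        by (simp only:) (subst P.finsum_insert, auto)
      then have h: "h = u s \<otimes>\<^bsub>P\<^esub> monom P (w s) 0 \<oplus>\<^bsub>P\<^esub> ?low"
        using wc [OF s(1)] by simp
      have "monom P (b s) 0 \<otimes>\<^bsub>P\<^esub> (u s \<otimes>\<^bsub>P\<^esub> monom P (w s) 0) =
          monom P (b s) 0 \<otimes>\<^bsub>P\<^esub> h \<ominus>\<^bsub>P\<^esub> monom P (b s) 0 \<otimes>\<^bsub>P\<^esub> ?low"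
        unfolding h using lc uc [OF s(1)] wc [OF s(1)] bc [OF s(1)]
        by (simp add: P.r_distr P.add_minus_cancel)
      moreover have "monom P (b s) 0 \<otimes>\<^bsub>P\<^esub> (u s \<otimes>\<^bsub>P\<^esub> monom P (w s) 0) =
          u s \<otimes>\<^bsub>P\<^esub> monom P (w s \<otimes> b s) 0"
        using uc [OF s(1)] wc [OF s(1)] bc [OF s(1)] monom_mult [of "w s" "b s" 0 0]
        by (simp add: P.m_ac)
      ultimately show ?thesis
        using P.ideal_minus [OF N(1) bh P.ideal_l [OF N(1) low]] bc [OF s(1)] by simp
    qed
    have "w s \<otimes> b s \<in> G"
      unfolding G_def using us s(2) uc [OF s(1)] wc [OF s(1)] bc [OF s(1)]
      by (auto intro!: P.saturationI [of _ "u s"])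
    then show False using wb(3) [OF s(1)] by blast
  qed
  then show ?thesis using x F(4) by (auto simp: G_def I_def \<pp>_def)
qed

text \<open>
  Nakayama over \<open>R[X]\<close> localized at \<open>M[X]\<close> removes the correction term \<open>M I\<^sub>m\<close>: every element
  of \<open>I\<^sub>m\<close> becomes a multiple of \<open>f\<close> after multiplication by some polynomial outside \<open>M[X]\<close>.
\<close>

lemma gaussian_power_locally_multiple:
  assumes f: "gaussian_poly R f" and M: "primeideal M R"
  obtains m where "\<forall>x \<in> content_ideal R (f [^]\<^bsub>P\<^esub> (m::nat)).
    monom P x 0 \<in> saturation P (coeffs_in R M) (PIdl\<^bsub>P\<^esub> f)"
proof -
  note fc = gaussian_carr [OF f]
  obtain F m where F: "gaussian_poly R F" "deg R F \<le> deg R f" "Suc (deg R f) \<le> (m::nat)"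
    "content_ideal R F = content_ideal R (f [^]\<^bsub>P\<^esub> m)"
    by (rule gaussian_power_few_generators [OF f])
  note Fc = gaussian_carr [OF F(1)]
  have P: "primeideal (coeffs_in R M) P" by (rule primeideal_coeffs_in [OF M])
  have Q: "ideal (PIdl\<^bsub>P\<^esub> f) P" by (rule P.cgenideal_ideal [OF fc])
  have gens: "monom P (coeff P F l) 0 \<in> saturation P (coeffs_in R M) (PIdl\<^bsub>P\<^esub> f)"
    if "l \<in> {..deg R F}" for l
  proof (rule P.nakayama [OF P finite_atMost Q _ _ that])
    fix N i
    assume "ideal N P" "PIdl\<^bsub>P\<^esub> f \<subseteq> N" "i \<in> {..deg R F}"
      "\<And>p l. p \<in> coeffs_in R M \<Longrightarrow> l \<in> {..deg R F} \<Longrightarrow>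
        p \<otimes>\<^bsub>P\<^esub> monom P (coeff P F l) 0 \<in> N"
    then show "monom P (coeff P F i) 0 \<in> saturation P (coeffs_in R M) N"
      using P.cgenideal_self [OF fc] coeff_in_content [OF Fc]
      by (intro gaussian_power_in_saturation [OF f M Fc F(2-4)]) auto
  qed (use Fc in auto)
  let ?K = "{x \<in> carrier R. monom P x 0 \<in> saturation P (coeffs_in R M) (PIdl\<^bsub>P\<^esub> f)}"
  have "content_ideal R F \<subseteq> ?K"
    unfolding content_ideal_def P_def [symmetric]
    by (rule R.genideal_minimal [OF ideal_contraction [OF P.ideal_saturation [OF P Q]]])
      (use gens Fc in auto)
  then show thesis using that F(4) by auto
qed

end


section \<open>Comparison with the localization\<close>

context cring_mult_set
begin

lemma saturation_complement: "saturation R (carrier R - S) N = {x \<in> carrier R. \<exists>s \<in> S. s \<otimes> x \<in> N}"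
  by (auto simp: saturation_def)

lemma saturation_complementI:
  "s \<in> S \<Longrightarrow> s \<otimes> x \<in> N \<Longrightarrow> x \<in> carrier R \<Longrightarrow> x \<in> saturation R (carrier R - S) N"
  unfolding saturation_complement by (rule CollectI, rule conjI, assumption, rule bexI)

lemma genideal_loc_map_image:
  assumes I: "ideal I R"
  shows "Idl\<^bsub>L\<^esub> (loc_map R S ` I) = {fr x s | x s. x \<in> I \<and> s \<in> S}" (is "_ = ?E")
proof
  interpret L: cring L by (rule cring_localization)
  note Ic = ideal_carr [OF I]
  have EI: "fr x s \<in> ?E" if "x \<in> I" "s \<in> S" for x s using that by blast
  have E: "ideal ?E L"
  proof (rule L.idealI_comm)
    show "?E \<subseteq> carrier L" by (clarify, rule loc_frac_closed [OF Ic])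
    show "\<zero>\<^bsub>L\<^esub> \<in> ?E" unfolding loc_zero by (rule EI [OF ideal_zero [OF I]]) simp
  next
    fix x y assume "x \<in> ?E" "y \<in> ?E"
    then obtain a s b t where e: "a \<in> I" "s \<in> S" "x = fr a s" "b \<in> I" "t \<in> S" "y = fr b t"
      by blast
    then have "x \<oplus>\<^bsub>L\<^esub> y = fr (a \<otimes> t \<oplus> b \<otimes> s) (s \<otimes> t)"
      using Ic by (simp add: loc_frac_add)
    moreover have "a \<otimes> t \<oplus> b \<otimes> s \<in> I" "s \<otimes> t \<in> S"
      using e by (auto intro!: ideal_add [OF I] ideal_r [OF I])
    ultimately show "x \<oplus>\<^bsub>L\<^esub> y \<in> ?E" by blast
  next
    fix r x assume r: "r \<in> carrier L" and "x \<in> ?E"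
    then obtain a s where e: "a \<in> I" "s \<in> S" "x = fr a s" by blast
    obtain c t where c: "c \<in> carrier R" "t \<in> S" "r = fr c t" using loc_carrierE [OF r] .
    have "r \<otimes>\<^bsub>L\<^esub> x = fr (c \<otimes> a) (t \<otimes> s)" using e c Ic by (simp add: loc_frac_mult)
    moreover have "c \<otimes> a \<in> I" "t \<otimes> s \<in> S" using e c by (auto intro!: ideal_l [OF I])
    ultimately show "r \<otimes>\<^bsub>L\<^esub> x \<in> ?E" by blast
  qed
  have "loc_map R S ` I \<subseteq> ?E"
    unfolding loc_map_def by (rule image_subsetI, rule EI) simp_all
  then show "Idl\<^bsub>L\<^esub> (loc_map R S ` I) \<subseteq> ?E" by (rule L.genideal_minimal [OF E])
  have im: "loc_map R S ` I \<subseteq> carrier L"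
    unfolding loc_map_def by (clarify, rule loc_frac_closed [OF Ic one_closed])
  note G = L.genideal_ideal [OF im]
  show "?E \<subseteq> Idl\<^bsub>L\<^esub> (loc_map R S ` I)"
  proof
    fix x assume "x \<in> ?E"
    then obtain a s where e: "a \<in> I" "s \<in> S" "x = fr a s" by blast
    have "fr a \<one> \<in> Idl\<^bsub>L\<^esub> (loc_map R S ` I)"
      using L.genideal_self [OF im] e(1) by (auto simp: loc_map_def)
    from L.ideal_l [OF G this, of "fr \<one> s"] show "x \<in> Idl\<^bsub>L\<^esub> (loc_map R S ` I)"
      using e Ic by (simp add: loc_frac_mult)
  qed
qed

lemma loc_frac_mem_extension:
  assumes "ideal I R" "x \<in> I" "s \<in> S"
  shows "fr x s \<in> Idl\<^bsub>L\<^esub> (loc_map R S ` I)"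
  unfolding genideal_loc_map_image [OF assms(1)] using assms(2,3) by blast

text \<open>
  A generator of the extended ideal may be changed by a unit, hence taken of the form \<open>a / 1\<close>
  with \<open>a \<in> I\<close>.
\<close>

lemma principalideal_extension_iff:
  assumes I: "ideal I R"
  shows "principalideal (Idl\<^bsub>L\<^esub> (loc_map R S ` I)) L \<longleftrightarrow>
    (\<exists>a \<in> I. I \<subseteq> saturation R (carrier R - S) (PIdl a))"
proof
  interpret L: cring L by (rule cring_localization)
  note Ic = ideal_carr [OF I]
  note E = genideal_loc_map_image [OF I]
  have im: "loc_map R S ` I \<subseteq> carrier L"
    unfolding loc_map_def by (clarify, rule loc_frac_closed [OF Ic one_closed])
  {
    assume "principalideal (Idl\<^bsub>L\<^esub> (loc_map R S ` I)) L"
    then obtain g where g: "g \<in> carrier L" "Idl\<^bsub>L\<^esub> (loc_map R S ` I) = PIdl\<^bsub>L\<^esub> g"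
      using principalideal.generate L.cgenideal_eq_genideal by metis
    have "g \<in> Idl\<^bsub>L\<^esub> (loc_map R S ` I)" unfolding g(2) by (rule L.cgenideal_self [OF g(1)])
    then obtain a s where a: "a \<in> I" "s \<in> S" "g = fr a s" unfolding E by blast
    have "b \<in> saturation R (carrier R - S) (PIdl a)" if b: "b \<in> I" for b
    proof -
      have "fr b \<one> \<in> PIdl\<^bsub>L\<^esub> g" 
        unfolding g(2) [symmetric] by (rule loc_frac_mem_extension [OF I b]) simp
      then obtain r' where r': "r' \<in> carrier L" "fr b \<one> = r' \<otimes>\<^bsub>L\<^esub> g"
        by (auto simp: cgenideal_def)
      obtain r t where r: "r \<in> carrier R" "t \<in> S" "r' = fr r t" using loc_carrierE [OF r'(1)] .
      have "fr b \<one> = fr (r \<otimes> a) (t \<otimes> s)" using r'(2) a r Ic by (simp add: loc_frac_mult)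
      then obtain u where u: "u \<in> S" "u \<otimes> (b \<otimes> (t \<otimes> s)) = u \<otimes> (r \<otimes> a \<otimes> \<one>)"
        using a r Ic b by (auto simp: loc_frac_eq_iff)
      have "(u \<otimes> (t \<otimes> s)) \<otimes> b = (u \<otimes> r) \<otimes> a"
        using u a r Ic b by (simp add: m_ac)
      then have "(u \<otimes> (t \<otimes> s)) \<otimes> b \<in> PIdl a" using u r by (auto simp: cgenideal_def)
      then show ?thesis by (rule saturation_complementI [rotated]) (use u a r Ic b in simp_all)
    qed
    then show "\<exists>a \<in> I. I \<subseteq> saturation R (carrier R - S) (PIdl a)" using a(1) by blast
  next
    assume "\<exists>a \<in> I. I \<subseteq> saturation R (carrier R - S) (PIdl a)"
    then obtain a where a: "a \<in> I" "I \<subseteq> saturation R (carrier R - S) (PIdl a)" by blast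
    have ac: "fr a \<one> \<in> carrier L" by (rule loc_frac_closed [OF Ic [OF a(1)]]) simp
    have "Idl\<^bsub>L\<^esub> (loc_map R S ` I) = PIdl\<^bsub>L\<^esub> (fr a \<one>)"
    proof
      show "PIdl\<^bsub>L\<^esub> (fr a \<one>) \<subseteq> Idl\<^bsub>L\<^esub> (loc_map R S ` I)"
        by (intro L.cgenideal_minimal L.genideal_ideal im loc_frac_mem_extension [OF I a(1)]) simp
      show "Idl\<^bsub>L\<^esub> (loc_map R S ` I) \<subseteq> PIdl\<^bsub>L\<^esub> (fr a \<one>)"
        unfolding E
      proof clarify
        fix b s assume b: "b \<in> I" "s \<in> S"
        from subsetD [OF a(2) b(1)]
        obtain t r where t: "t \<in> S" "r \<in> carrier R" "t \<otimes> b = r \<otimes> a"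
          unfolding saturation_complement cgenideal_def by blast
        have "fr b s = fr (r \<otimes> a) (t \<otimes> s)"
          using b t Ic by (simp add: loc_frac_cancel flip: t(3))
        also have "\<dots> = fr r (t \<otimes> s) \<otimes>\<^bsub>L\<^esub> fr a \<one>" using a b t Ic by (simp add: loc_frac_mult)
        finally have "fr b s = fr r (t \<otimes> s) \<otimes>\<^bsub>L\<^esub> fr a \<one>" .
        moreover have "fr r (t \<otimes> s) \<in> carrier L" using b t by (intro loc_frac_closed) simp_all
        ultimately show "fr b s \<in> PIdl\<^bsub>L\<^esub> (fr a \<one>)" unfolding cgenideal_def by blast
      qed
    qed
    then show "principalideal (Idl\<^bsub>L\<^esub> (loc_map R S ` I)) L"
      using L.cgenideal_is_principalideal [OF ac] by simp
  }
qed

lemma zero_divisor_in_localization_kernel: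
  assumes L: "domain L" and xy: "x \<in> carrier R" "y \<in> carrier R"
    "x \<otimes> y \<in> saturation R (carrier R - S) {\<zero>}"
  shows "x \<in> saturation R (carrier R - S) {\<zero>} \<or> y \<in> saturation R (carrier R - S) {\<zero>}"
proof -
  have ker: "fr z \<one> = \<zero>\<^bsub>L\<^esub> \<longleftrightarrow> z \<in> saturation R (carrier R - S) {\<zero>}" if "z \<in> carrier R" for z
    unfolding loc_zero using that by (simp add: loc_frac_eq_iff saturation_complement)
  have "fr x \<one> \<otimes>\<^bsub>L\<^esub> fr y \<one> = \<zero>\<^bsub>L\<^esub>"
    using ker [of "x \<otimes> y"] xy by (simp add: loc_frac_mult)
  then have "fr x \<one> = \<zero>\<^bsub>L\<^esub> \<or> fr y \<one> = \<zero>\<^bsub>L\<^esub>"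
    using xy by (intro domain.integral [OF L]) simp_all
  then show ?thesis by (simp only: ker xy)
qed

end

section \<open>Gaussian polynomials and locally principal content\<close>

context UP_cring
begin

text \<open>
  If \<open>p\<^sub>m\<close> is the first coefficient of \<open>p\<close> outside \<open>M\<close>, then, up to \<open>M\<close>-multiples of coefficients of
  \<open>g\<close> and multiples of earlier coefficients of \<open>g\<close>, the product \<open>p\<^sub>m g\<^sub>j\<close> is a coefficient of
  \<open>p g\<close>. Induction on \<open>j\<close> and Nakayama give that \<open>g\<close> and \<open>p g\<close> have the same content at \<open>M\<close>.
\<close>

lemma coeff_in_saturation_content_mult:
  assumes M: "primeideal M R" and p: "p \<in> carrier P" "p \<notin> coeffs_in R M" and g: "g \<in> carrier P"
  shows "coeff P g k \<in> saturation R M (content_ideal R (p \<otimes>\<^bsub>P\<^esub> g))"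
proof -
  have pg: "p \<otimes>\<^bsub>P\<^esub> g \<in> carrier P" using p g by simp
  note Q = ideal_content [OF pg]
  obtain m where m: "coeff P p m \<notin> M" "\<And>i. i < m \<Longrightarrow> coeff P p i \<in> M"
    using least_coeff_notin [OF p] by blast
  have *: "coeff P g j \<in> saturation R M N"
    if N: "ideal N R" "content_ideal R (p \<otimes>\<^bsub>P\<^esub> g) \<subseteq> N"
      and gen: "\<And>c l. c \<in> M \<Longrightarrow> l \<in> {..deg R g} \<Longrightarrow> c \<otimes> coeff P g l \<in> N" for N j
  proof (induction j rule: less_induct)
    case (less j)
    have Mid: "ideal M R" using M by (rule primeideal.axioms)
    note S = R.ideal_saturation [OF M N(1)]
    have gen': "c \<otimes> coeff P g l \<in> N" if "c \<in> M" for c l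
      using gen [OF that] g that R.ideal_carr [OF Mid] R.ideal_zero [OF N(1)]
      by (cases "l \<le> deg R g") (simp_all add: deg_aboveD)
    have d: "coeff P (p \<otimes>\<^bsub>P\<^esub> g) (m + j) \<ominus> coeff P p m \<otimes> coeff P g j \<in> saturation R M N"
    proof (rule coeff_mult_mod [OF S p(1) g])
      fix i assume "i < m"
      then show "coeff P p i \<otimes> coeff P g (m + j - i) \<in> saturation R M N"
        using gen' m(2) R.subset_saturation [OF M N(1)] by blast
    next
      fix i assume "i < j"
      then show "coeff P p (m + j - i) \<otimes> coeff P g i \<in> saturation R M N"
        using p(1) by (intro R.ideal_l [OF S less.IH]) auto
    qed
    have "coeff P (p \<otimes>\<^bsub>P\<^esub> g) (m + j) \<in> saturation R M N"
      using coeff_in_content [OF pg] N(2) R.subset_saturation [OF M N(1)] by blast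
    from R.ideal_mem_if_diff_mem [OF S this d]
    have "coeff P p m \<otimes> coeff P g j \<in> saturation R M N" using p(1) g by simp
    then show ?case
      using R.saturation_cancel [OF M _ _, of "coeff P g j" "coeff P p m"] p(1) g m(1) by simp
  qed
  show ?thesis
  proof (cases "k \<le> deg R g")
    case True
    show ?thesis
    proof (rule R.nakayama [OF M finite_atMost Q])
      fix N i assume "ideal N R" "content_ideal R (p \<otimes>\<^bsub>P\<^esub> g) \<subseteq> N"
        "\<And>c l. c \<in> M \<Longrightarrow> l \<in> {..deg R g} \<Longrightarrow> c \<otimes> coeff P g l \<in> N"
      then show "coeff P g i \<in> saturation R M N" by (rule *)
    qed (use True g in auto)
  next
    case False
    then show ?thesis
      using R.ideal_zero [OF R.ideal_saturation [OF M Q]] g by (simp add: deg_aboveD)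
  qed
qed

text \<open>
  Let \<open>Z\<close> be the kernel of \<open>R \<rightarrow> R\<^sub>M\<close>. If a power of the content lies in \<open>Z\<close>, so does the content,
  \<open>Z\<close> being prime. Otherwise some \<open>z \<notin> Z\<close> in that power satisfies \<open>z s = f g\<close> with
  \<open>s \<notin> M[X]\<close>. Then \<open>c(f) c(g) = z c(s)\<close> generates the same ideal as \<open>z\<close> at \<open>M\<close>, which makes
  \<open>c(f)\<close> invertible there: one of the products satisfies \<open>a x = z r\<close> with \<open>r \<notin> M\<close>, and for
  every \<open>b \<in> c(f)\<close> the element \<open>b x\<close> is a multiple of \<open>z\<close>, hence of \<open>a x\<close> at \<open>M\<close>; cancel \<open>x\<close>.
\<close>

lemma content_locally_principal_if_gaussian:
  assumes f: "gaussian_poly R f" and M: "primeideal M R"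
    and dom: "\<And>x y. x \<in> carrier R \<Longrightarrow> y \<in> carrier R \<Longrightarrow> x \<otimes> y \<in> saturation R M {\<zero>} \<Longrightarrow>
      x \<in> saturation R M {\<zero>} \<or> y \<in> saturation R M {\<zero>}"
  shows "\<exists>a \<in> content_ideal R f. content_ideal R f \<subseteq> saturation R M (PIdl a)"
proof -
  define Z where "Z = saturation R M {\<zero>}"
  note fc = gaussian_carr [OF f]
  have Mid: "ideal M R" using M by (rule primeideal.axioms)
  have Z: "ideal Z R" unfolding Z_def by (rule R.ideal_saturation [OF M R.zeroideal])
  have If: "ideal (content_ideal R f) R" by (rule ideal_content [OF fc])
  obtain m where m: "\<forall>x \<in> content_ideal R (f [^]\<^bsub>P\<^esub> (m::nat)).
      monom P x 0 \<in> saturation P (coeffs_in R M) (PIdl\<^bsub>P\<^esub> f)"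
    by (rule gaussian_power_locally_multiple [OF f M])
  show ?thesis
  proof (cases "content_ideal R (f [^]\<^bsub>P\<^esub> m) \<subseteq> Z")
    case True
    have "a \<in> saturation R M (PIdl \<zero>)" if a: "a \<in> content_ideal R f" for a
    proof -
      have ac: "a \<in> carrier R" by (rule R.ideal_carr [OF If a])
      have "a [^] k \<in> content_ideal R (f [^]\<^bsub>P\<^esub> k)" for k :: nat
      proof (induction k)
        case 0
        then show ?case by (simp add: content_one)
      next
        case (Suc k)
        then show ?case
          using a content_gaussian_mult [OF gaussian_pow [OF f] fc]
          by (simp add: ideal_prod.prod)
      qed
      then have "a [^] m \<in> Z" using True by blast
      moreover have "a [^] k \<in> Z \<Longrightarrow> a \<in> Z" for k :: nat
      proof (induction k)
        case 0
        then show ?case using R.ideal_r [OF Z, of \<one> a] ac by simp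
      next
        case (Suc k)
        then show ?case using dom [of "a [^] k" a] ac by (auto simp: Z_def)
      qed
      ultimately have "a \<in> Z" by blast
      then show ?thesis
        using R.saturation_mono [of "{\<zero>}" "PIdl \<zero>"] R.cgenideal_self [OF R.zero_closed]
        by (auto simp: Z_def)
    qed
    then show ?thesis using R.ideal_zero [OF If] by blast
  next
    case False
    then obtain z where z: "z \<in> content_ideal R (f [^]\<^bsub>P\<^esub> m)" "z \<notin> Z" by blast
    have zc: "z \<in> carrier R"
      using z(1) ideal_content [of "f [^]\<^bsub>P\<^esub> m"] fc by (intro R.ideal_carr [of _ z]) auto
    obtain s g where s: "s \<in> carrier P" "s \<notin> coeffs_in R M" and g: "g \<in> carrier P"
      and sg: "s \<otimes>\<^bsub>P\<^esub> monom P z 0 = g \<otimes>\<^bsub>P\<^esub> f"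
      using bspec [OF m z(1)] unfolding saturation_def cgenideal_def by blast
    have fg: "monom P z 0 \<otimes>\<^bsub>P\<^esub> s = f \<otimes>\<^bsub>P\<^esub> g"
      using sg s g fc zc by (simp add: P.m_comm)
    note Ig = ideal_content [OF g]
    have prod: "content_ideal R f \<cdot> content_ideal R g = content_ideal R (monom P z 0 \<otimes>\<^bsub>P\<^esub> s)"
      unfolding fg by (simp add: content_gaussian_mult [OF f g])
    obtain j where j: "coeff P s j \<notin> M" using least_coeff_notin [OF s] by blast
    let ?K = "saturation R M {z \<otimes> r | r. r \<in> M}"
    have K: "ideal ?K R" by (rule R.ideal_saturation [OF M R.ideal_scale [OF Mid zc]])
    \<comment> \<open>Otherwise the product of the contents, which contains \<open>z s\<^sub>j\<close> with \<open>s\<^sub>j \<notin> M\<close>, would lie in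
      \<open>z M\<close> at \<open>M\<close>, so that \<open>z\<close> would vanish in \<open>R\<^sub>M\<close>.\<close>
    have "\<exists>a x. a \<in> content_ideal R f \<and> x \<in> content_ideal R g \<and> a \<otimes> x \<notin> ?K"
    proof (rule ccontr)
      assume "\<not> ?thesis"
      then have "content_ideal R f \<cdot> content_ideal R g \<subseteq> ?K"
        by (intro R.ideal_prod_subset [OF K]) blast
      then have "coeff P (monom P z 0 \<otimes>\<^bsub>P\<^esub> s) j \<in> ?K"
        unfolding prod using coeff_in_content [of "monom P z 0 \<otimes>\<^bsub>P\<^esub> s" j] zc s by auto
      then have "coeff P s j \<otimes> z \<in> ?K"
        using zc s by (simp add: coeff_const_mult R.m_comm del: coeff_mult)
      then have "z \<in> ?K"
        using R.saturation_cancel [OF M zc _, of "coeff P s j"] s j by simp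
      then show False
        using R.mem_saturation_zero_if_mem_saturation_scale [OF M] z(2) by (simp add: Z_def)
    qed
    then obtain a x where a: "a \<in> content_ideal R f" and x: "x \<in> content_ideal R g"
      and ax: "a \<otimes> x \<notin> ?K" by blast
    have ac: "a \<in> carrier R" by (rule R.ideal_carr [OF If a])
    have xc: "x \<in> carrier R" by (rule R.ideal_carr [OF Ig x])
    have zmult: "\<exists>r \<in> carrier R. b \<otimes> x = z \<otimes> r" if b: "b \<in> content_ideal R f" for b
    proof -
      have "content_ideal R (monom P z 0 \<otimes>\<^bsub>P\<^esub> s) \<subseteq> {z \<otimes> r | r. r \<in> carrier R}"
        using zc s
        by (subst content_subset_iff [OF _ R.ideal_scale [OF R.oneideal zc]])
          (auto simp: coeffs_in_iff coeff_const_mult simp del: coeff_mult)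
      then show ?thesis using ideal_prod.prod [OF b x, of R] unfolding prod by blast
    qed
    obtain r where r: "r \<in> carrier R" "a \<otimes> x = z \<otimes> r" using zmult [OF a] by blast
    have rM: "r \<notin> M"
    proof
      assume "r \<in> M"
      then have "a \<otimes> x \<in> {z \<otimes> r | r. r \<in> M}" using r(2) by blast
      then show False
        using ax R.subset_saturation [OF M R.ideal_scale [OF Mid zc]] by blast
    qed
    have xZ: "x \<notin> Z"
    proof
      assume "x \<in> Z"
      then have "a \<otimes> x \<in> Z" using ac by (intro R.ideal_l [OF Z])
      moreover have "Z \<subseteq> ?K"
        unfolding Z_def
        using R.ideal_zero [OF R.ideal_scale [OF Mid zc]] by (intro R.saturation_mono) blast
      ultimately show False using ax by blast
    qed
    have "b \<in> saturation R M (PIdl a)" if b: "b \<in> content_ideal R f" for b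
    proof -
      have bc: "b \<in> carrier R" by (rule R.ideal_carr [OF If b])
      obtain r' where r': "r' \<in> carrier R" "b \<otimes> x = z \<otimes> r'" using zmult [OF b] by blast
      have "x \<otimes> (r \<otimes> b) = x \<otimes> (r' \<otimes> a)"
      proof -
        have "x \<otimes> (r \<otimes> b) = r \<otimes> (b \<otimes> x)" using bc xc r by (simp add: R.m_ac)
        also have "\<dots> = r' \<otimes> (z \<otimes> r)" unfolding r'(2) using r r' zc by (simp add: R.m_ac)
        also have "\<dots> = x \<otimes> (r' \<otimes> a)" unfolding r(2) [symmetric] using ac xc r' by (simp add: R.m_ac)
        finally show ?thesis .
      qed
      then have "x \<otimes> (r' \<otimes> a \<ominus> r \<otimes> b) = \<zero>"
        using bc ac xc r r' by (simp add: a_minus_def R.r_distr R.r_minus R.r_neg)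
      then have "x \<otimes> (r' \<otimes> a \<ominus> r \<otimes> b) \<in> Z" using R.ideal_zero [OF Z] by simp
      then have "r' \<otimes> a \<ominus> r \<otimes> b \<in> Z"
        using dom [of x "r' \<otimes> a \<ominus> r \<otimes> b"] xZ bc ac xc r r' by (simp add: Z_def)
      then obtain t where t: "t \<in> carrier R - M" "t \<otimes> (r' \<otimes> a \<ominus> r \<otimes> b) = \<zero>"
        unfolding Z_def saturation_def by blast
      note Pa = R.cgenideal_ideal [OF ac]
      have "t \<otimes> (r' \<otimes> a) \<in> PIdl a"
        using t r' by (intro R.ideal_l [OF Pa] R.cgenideal_self [OF ac]) auto
      moreover have "t \<otimes> (r' \<otimes> a) \<ominus> (t \<otimes> r) \<otimes> b \<in> PIdl a"
      proof -
        have "t \<otimes> (r' \<otimes> a) \<ominus> (t \<otimes> r) \<otimes> b = t \<otimes> (r' \<otimes> a \<ominus> r \<otimes> b)"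
          using t(1) bc ac r r' by (simp add: a_minus_def R.r_distr R.r_minus R.m_assoc)
        then show ?thesis using t(2) R.ideal_zero [OF Pa] by simp
      qed
      ultimately have "(t \<otimes> r) \<otimes> b \<in> PIdl a"
        by (rule R.ideal_mem_if_diff_mem [OF Pa]) (use t(1) r(1) bc in simp)
      then show ?thesis
        using bc R.prime_mult [OF M t(1), of r] r(1) rM by (intro R.saturationI) auto
    qed
    then show ?thesis using a by blast
  qed
qed

text \<open>
  Fix \<open>M\<close> and let \<open>d \<in> c(f)\<close> generate the content at \<open>M\<close>, so that \<open>s f = d p\<close> with
  \<open>s \<notin> M\<close>. Unless \<open>d\<close> vanishes in \<open>R\<^sub>M\<close>, Nakayama applied to \<open>d \<in> c(f)\<close> shows
  \<open>p \<notin> M[X]\<close>, so that \<open>g\<close> and \<open>p g\<close> have the same content at \<open>M\<close>; multiplying by \<open>d\<close> gives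
  \<open>c(f) c(g) \<subseteq> c(f g)\<close> at \<open>M\<close>. All maximal ideals together give the inclusion in \<open>R\<close>.
\<close>

lemma gaussian_if_content_locally_principal:
  assumes f: "f \<in> carrier P"
    and loc: "\<And>M. maximalideal M R \<Longrightarrow>
      \<exists>d \<in> content_ideal R f. content_ideal R f \<subseteq> saturation R M (PIdl d)"
  shows "gaussian_poly R f"
  unfolding gaussian_iff
proof (intro conjI ballI equalityI)
  fix g assume g: "g \<in> carrier P"
  show "content_ideal R (f \<otimes>\<^bsub>P\<^esub> g) \<subseteq> content_ideal R f \<cdot> content_ideal R g"
    by (rule content_mult_subset [OF f g])
  have fgc: "f \<otimes>\<^bsub>P\<^esub> g \<in> carrier P" using f g by simp
  note Q = ideal_content [OF fgc]
  have If: "ideal (content_ideal R f) R" by (rule ideal_content [OF f])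
  have Ig: "ideal (content_ideal R g) R" by (rule ideal_content [OF g])
  have coeffs: "coeff P f i \<otimes> coeff P g k \<in> saturation R M (content_ideal R (f \<otimes>\<^bsub>P\<^esub> g))"
    if max: "maximalideal M R" for M i k
  proof -
    have M: "primeideal M R" by (rule R.maximalideal_prime [OF max])
    have Mid: "ideal M R" using M by (rule primeideal.axioms)
    note SQ = R.ideal_saturation [OF M Q]
    obtain d where d: "d \<in> content_ideal R f" "content_ideal R f \<subseteq> saturation R M (PIdl d)"
      using loc [OF max] by blast
    have dc: "d \<in> carrier R" by (rule R.ideal_carr [OF If d(1)])
    note D = R.cgenideal_ideal [OF dc]
    show ?thesis
    proof (cases "d \<in> saturation R M {\<zero>}")
      case True
      have "PIdl d \<subseteq> saturation R M {\<zero>}"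
        by (rule R.cgenideal_minimal [OF R.ideal_saturation [OF M R.zeroideal] True])
      then have "saturation R M (PIdl d) \<subseteq> saturation R M {\<zero>}"
        using R.saturation_mono R.saturation_idem [OF M] by blast
      also have "\<dots> \<subseteq> saturation R M (content_ideal R (f \<otimes>\<^bsub>P\<^esub> g))"
        using R.ideal_zero [OF Q] by (intro R.saturation_mono) blast
      finally have "coeff P f i \<in> saturation R M (content_ideal R (f \<otimes>\<^bsub>P\<^esub> g))"
        using d(2) coeff_in_content [OF f] by blast
      then show ?thesis using g by (intro R.ideal_r [OF SQ]) auto
    next
      case False
      obtain s where s: "s \<in> carrier R - M" "\<forall>i \<in> {..deg R f}. s \<otimes> coeff P f i \<in> PIdl d"
        by (rule R.saturation_common_denominator [OF M D finite_atMost, of "deg R f" "coeff P f"])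
          (use d(2) coeff_in_content [OF f] in blast)
      have "\<forall>i \<in> {..deg R f}. \<exists>b. b \<in> carrier R \<and> s \<otimes> coeff P f i = b \<otimes> d"
        using s(2) by (auto simp: cgenideal_def)
      from bchoice [OF this] obtain b where b: "\<forall>i \<in> {..deg R f}. b i \<in> carrier R \<and>
          s \<otimes> coeff P f i = b i \<otimes> d" ..
      let ?p = "\<lambda>i. if i \<le> deg R f then b i else \<zero>"
      have p: "?p \<in> carrier P" "coeff P ?p i = ?p i" for i
        using poly_of_coeffs [of ?p "deg R f"] b by auto
      have sf: "s \<otimes> coeff P f i = coeff P ?p i \<otimes> d" for i
        unfolding p(2) using b s(1) dc f by (auto simp: deg_aboveD)
      \<comment> \<open>If all coefficients of \<open>p\<close> were in \<open>M\<close>, then \<open>c(f) \<subseteq> d M\<close> at \<open>M\<close>, and \<open>d \<in> c(f)\<close> would vanish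
        in \<open>R\<^sub>M\<close>.\<close>
      have pM: "?p \<notin> coeffs_in R M"
      proof
        assume "?p \<in> coeffs_in R M"
        then have pc: "coeff P ?p i \<in> M" for i by (simp only: coeffs_in_iff)
        let ?K = "saturation R M {d \<otimes> r | r. r \<in> M}"
        have K: "ideal ?K R" by (rule R.ideal_saturation [OF M R.ideal_scale [OF Mid dc]])
        have "coeff P f i \<in> ?K" for i
        proof (rule R.saturationI [OF _ s(1)])
          have "s \<otimes> coeff P f i = d \<otimes> coeff P ?p i"
            unfolding sf using R.ideal_carr [OF Mid pc] dc by (simp add: R.m_comm)
          then show "s \<otimes> coeff P f i \<in> {d \<otimes> r | r. r \<in> M}" using pc by blast
        qed (use f in simp)
        then have "content_ideal R f \<subseteq> ?K"
          using f by (simp add: content_subset_iff [OF f K] coeffs_in_iff)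
        then show False
          using d(1) False R.mem_saturation_zero_if_mem_saturation_scale [OF M] by blast
      qed
      have sfdp: "monom P s 0 \<otimes>\<^bsub>P\<^esub> f = monom P d 0 \<otimes>\<^bsub>P\<^esub> ?p"
      proof (rule up_eqI)
        fix n
        have "coeff P ?p n \<in> carrier R" by (rule coeff_closed [OF p(1)])
        then show "coeff P (monom P s 0 \<otimes>\<^bsub>P\<^esub> f) n = coeff P (monom P d 0 \<otimes>\<^bsub>P\<^esub> ?p) n"
          using s(1) dc sf f p(1)
          by (subst (1 2) coeff_const_mult) (auto simp: R.m_comm [of d])
      qed (use s(1) dc f p(1) in simp_all)
      have pgc: "?p \<otimes>\<^bsub>P\<^esub> g \<in> carrier P" using p(1) g by (rule UP_mult_closed)
      have sub: "content_ideal R (?p \<otimes>\<^bsub>P\<^esub> g) \<subseteq>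
          {y \<in> carrier R. d \<otimes> y \<in> content_ideal R (f \<otimes>\<^bsub>P\<^esub> g)}"
      proof (subst content_subset_iff [OF pgc R.ideal_preimage_mult [OF Q dc]],
          unfold coeffs_in_iff, intro conjI allI pgc CollectI)
        fix n
        show "coeff P (?p \<otimes>\<^bsub>P\<^esub> g) n \<in> carrier R" by (rule coeff_closed [OF pgc])
        have "monom P d 0 \<otimes>\<^bsub>P\<^esub> (?p \<otimes>\<^bsub>P\<^esub> g) = monom P s 0 \<otimes>\<^bsub>P\<^esub> (f \<otimes>\<^bsub>P\<^esub> g)"
          using sfdp s(1) dc f p(1) g by (simp add: P.m_assoc [symmetric])
        then have "d \<otimes> coeff P (?p \<otimes>\<^bsub>P\<^esub> g) n = s \<otimes> coeff P (f \<otimes>\<^bsub>P\<^esub> g) n"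
          using coeff_const_mult [OF dc pgc, of n] coeff_const_mult [OF _ fgc, of s n] s(1)
          by simp
        then show "d \<otimes> coeff P (?p \<otimes>\<^bsub>P\<^esub> g) n \<in> content_ideal R (f \<otimes>\<^bsub>P\<^esub> g)"
          using R.ideal_l [OF Q coeff_in_content [OF fgc], of s n] s(1) by simp
      qed
      obtain t where t: "t \<in> carrier R - M" "t \<otimes> coeff P g k \<in> content_ideal R (?p \<otimes>\<^bsub>P\<^esub> g)"
        using coeff_in_saturation_content_mult [OF M p(1) pM g, of k]
        unfolding saturation_def by blast
      have dt: "d \<otimes> (t \<otimes> coeff P g k) \<in> content_ideal R (f \<otimes>\<^bsub>P\<^esub> g)" using sub t(2) by blast
      have pic: "coeff P ?p i \<in> carrier R" by (rule coeff_closed [OF p(1)])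
      have "(t \<otimes> s) \<otimes> (coeff P f i \<otimes> coeff P g k) = t \<otimes> (s \<otimes> coeff P f i) \<otimes> coeff P g k"
        using t(1) s(1) f g by (simp add: R.m_assoc)
      also have "\<dots> = coeff P ?p i \<otimes> (d \<otimes> (t \<otimes> coeff P g k))"
        unfolding sf using t(1) dc g pic by (simp add: R.m_ac del: p(2))
      also have "\<dots> \<in> content_ideal R (f \<otimes>\<^bsub>P\<^esub> g)" by (rule R.ideal_l [OF Q dt pic])
      finally show ?thesis
        using f g by (intro R.saturationI [OF _ R.prime_mult [OF M t(1) s(1)]]) auto
    qed
  qed
  have fg: "coeff P f i \<otimes> coeff P g k \<in> content_ideal R (f \<otimes>\<^bsub>P\<^esub> g)" for i k
    using f g coeffs by (intro R.mem_ideal_if_locally_mem [OF Q]) auto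
  show "content_ideal R f \<cdot> content_ideal R g \<subseteq> content_ideal R (f \<otimes>\<^bsub>P\<^esub> g)"
  proof (rule R.ideal_prod_subset [OF Q])
    have fx: "content_ideal R f \<subseteq> {x \<in> carrier R. coeff P g k \<otimes> x \<in> content_ideal R (f \<otimes>\<^bsub>P\<^esub> g)}" for k
      using fg f g
      by (subst content_subset_iff [OF f R.ideal_preimage_mult [OF Q]])
        (auto simp: coeffs_in_iff R.m_comm)
    fix x y assume x: "x \<in> content_ideal R f" and y: "y \<in> content_ideal R g"
    have xc: "x \<in> carrier R" by (rule R.ideal_carr [OF If x])
    have "content_ideal R g \<subseteq> {y \<in> carrier R. x \<otimes> y \<in> content_ideal R (f \<otimes>\<^bsub>P\<^esub> g)}"
      using fx x g xc
      by (subst content_subset_iff [OF g R.ideal_preimage_mult [OF Q xc]])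
        (auto simp: coeffs_in_iff R.m_comm [of x])
    then show "x \<otimes> y \<in> content_ideal R (f \<otimes>\<^bsub>P\<^esub> g)" using y by blast
  qed
qed (rule f)

end

theorem theorem4:
  fixes R (structure) and f :: "nat \<Rightarrow> 'a"
  assumes "cring R"
    and "locally_domain R"
    and "f \<in> carrier (UP R)"
    and "f \<noteq> \<zero>\<^bsub>UP R\<^esub>"
  shows "gaussian_poly R f \<longleftrightarrow> locally_principal R (content_ideal R f)"
proof -
  interpret UP_cring R "UP R" using assms(1) by (simp add: UP_cring_def)
  note I = ideal_content [OF assms(3)]
  have loc: "principalideal (ideal_localization_at R M (content_ideal R f)) (localization_at R M) \<longleftrightarrow>
      (\<exists>a \<in> content_ideal R f. content_ideal R f \<subseteq> saturation R M (PIdl a))"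
    if "maximalideal M R" for M
  proof -
    interpret S: cring_mult_set R "carrier R - M"
      by (rule cring_mult_set_maximalideal [OF assms(1) that])
    have "M \<subseteq> carrier R"
      using R.ideal_carr [OF maximalideal.axioms(1) [OF that]] by blast
    then show ?thesis
      using S.principalideal_extension_iff [OF I]
      by (simp add: ideal_localization_at_def localization_at_def double_diff)
  qed
  show ?thesis
  proof
    assume g: "gaussian_poly R f"
    have "\<exists>a \<in> content_ideal R f. content_ideal R f \<subseteq> saturation R M (PIdl a)"
      if max: "maximalideal M R" for M
    proof (rule content_locally_principal_if_gaussian [OF g R.maximalideal_prime [OF max]])
      interpret S: cring_mult_set R "carrier R - M"
        by (rule cring_mult_set_maximalideal [OF assms(1) max])
      have "M \<subseteq> carrier R"
        using R.ideal_carr [OF maximalideal.axioms(1) [OF max]] by blast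
      then have e: "carrier R - (carrier R - M) = M" by blast
      have "domain (localization R (carrier R - M))"
        using assms(2) max by (simp add: locally_domain_def localization_at_def)
      then show "x \<in> saturation R M {\<zero>} \<or> y \<in> saturation R M {\<zero>}"
        if "x \<in> carrier R" "y \<in> carrier R" "x \<otimes> y \<in> saturation R M {\<zero>}" for x y
        using S.zero_divisor_in_localization_kernel [of x y] that unfolding e by blast
    qed
    then show "locally_principal R (content_ideal R f)"
      using I loc by (simp add: locally_principal_def)
  next
    assume "locally_principal R (content_ideal R f)"
    then show "gaussian_poly R f"
      using loc by (intro gaussian_if_content_locally_principal assms(3))
        (simp add: locally_principal_def)
  qed
qed

end
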